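(* Let $p=q\in(0,1)$ be a constant, let $\zeta\ge 40$ be a constant, and for each $n$ let $\lambda=\lambda_n=\frac{1}{\zeta n}$. Let $\mathcal{P}_\lambda$ be the planted matching model, $\mathcal{Q}=G(n,q)$, and $\check{K_2}(A)=\sum_{\{i,j\}\in\binom{[n]}{2}}(A_{ij}-q)$ the signed edge count. Then for $A\sim\mathcal{Q}$ and for each $n$, $$\log\frac{\mathrm{d}\mathcal{P}_\lambda}{\mathrm{d}\mathcal{Q}}(A)=-\frac{1-p}{p}\left(\frac{\mathbb{E}|M|}{n}\right)^2+\sqrt{\frac{2(1-p)}{p}}\ \frac{\mathbb{E}|M|}{n}\ \frac{\check{K_2}(A)}{\sqrt{\operatorname{Var}\check{K_2}(A)}}+O_{\mathbb{P}}\left(\frac{1}{p\sqrt n}\right),$$ where $\mathbb{E}|M|$ is the expected size of $M\sim\mu_\lambda$ and the variance is taken under $\mathcal{Q}$.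
   Context: A matching in a graph is a set of pairwise non-adjacent (vertex-disjoint) edges; the empty set is a matching. For a simple graph $G$ and $\lambda>0$, the monomer-dimer Gibbs measure on matchings $M$ of $G$ is $\mu_{\lambda,G}(M)=\lambda^{|M|}/Z_G(\lambda)$ with $Z_G(\lambda)=\sum_{M\subset G}\lambda^{|M|}$ (sum over all matchings $M$ in $G$, where $|M|$ is the number of edges). Write $\mu_\lambda=\mu_{\lambda,K_n}$, where $K_n$ is the complete graph on $[n]=\{1,\dots,n\}$. The planted matching model $\mathcal{P}_\lambda$ (with parameters $n,p,\lambda$) is the law of the adjacency matrix $A$ of a random graph on $[n]$ generated as follows: sample $M\sim\mu_\lambda$; conditionally on $M$, set $A_{ij}=1$ if $\{i,j\}\in M$, and let $A_{ij}\sim\mathrm{Bernoulli}(p)$ independently for $\{i,j\}\notin M$. The null model $\mathcal{Q}=G(n,q)$ is the Erdős–Rényi random graph on $[n]$, with all edges independent $\mathrm{Bernoulli}(q)$. $X_n=O_{\mathbb{P}}(a_n)$ means that $X_n/a_n$ is bounded in probability as $n\to\infty$. *)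

theory Defs
  imports "HOL-Probability.Probability"
begin

text \<open>
  A simple graph enters only through its edge set, a set of two-element sets of vertices;
  isolated vertices are irrelevant for matchings.
\<close>

definition complete_edges :: "nat \<Rightarrow> nat set set" where
  "complete_edges n = {e. e \<subseteq> {1..n} \<and> card e = 2}"

definition matchings :: "'v set set \<Rightarrow> 'v set set set" where
  "matchings E = {M. M \<subseteq> E \<and> pairwise disjnt M}"

definition matching_Z :: "'v set set \<Rightarrow> real \<Rightarrow> real" where
  "matching_Z E l = (\<Sum>M\<in>matchings E. l ^ card M)"

definition monomer_dimer :: "'v set set \<Rightarrow> real \<Rightarrow> 'v set set pmf" where
  "monomer_dimer E l =
     embed_pmf (\<lambda>M. if M \<in> matchings E then l ^ card M / matching_Z E l else 0)"

text \<open>The side conditions under which \<open>embed_pmf\<close> yields the intended law.\<close>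

lemma pmf_monomer_dimer:
  assumes "finite E" and "l > 0"
  shows "pmf (monomer_dimer E l) M =
           (if M \<in> matchings E then l ^ card M / matching_Z E l else 0)"
proof -
  have fin: "finite (matchings E)"
    using assms(1) by (auto simp: matchings_def)
  have "{} \<in> matchings E"
    by (simp add: matchings_def)
  hence Z: "matching_Z E l > 0"
    unfolding matching_Z_def using fin assms(2) by (intro sum_pos) auto
  let ?f = "\<lambda>M. if M \<in> matchings E then l ^ card M / matching_Z E l else 0"
  have nn: "0 \<le> ?f M" for M
    using assms(2) Z by simp
  have "(\<integral>\<^sup>+ M. ennreal (?f M) \<partial>count_space UNIV)
      = (\<integral>\<^sup>+ M. ennreal (?f M) \<partial>count_space (matchings E))"
    by (subst (2) nn_integral_count_space_indicator)
       (auto intro!: nn_integral_cong simp: indicator_def)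
  also have "\<dots> = (\<Sum>M\<in>matchings E. ennreal (?f M))"
    using fin by (rule nn_integral_count_space_finite)
  also have "\<dots> = ennreal (\<Sum>M\<in>matchings E. ?f M)"
    using nn by (rule sum_ennreal)
  also have "(\<Sum>M\<in>matchings E. ?f M) = 1"
    using Z by (simp add: sum_divide_distrib[symmetric] matching_Z_def)
  finally have "(\<integral>\<^sup>+ M. ennreal (?f M) \<partial>count_space UNIV) = 1"
    by simp
  thus ?thesis
    unfolding monomer_dimer_def using nn by (subst pmf_embed_pmf) auto
qed

text \<open>
  An adjacency matrix of a graph on \<open>{1..n}\<close> is symmetric, with entries in \<open>{0, 1}\<close> and zero
  diagonal. It is represented by its entries \<open>A {i, j}\<close>, indexed by unordered pairs, with
  \<open>True\<close> for 1 and \<open>False\<close> for 0. Entries outside \<open>complete_edges n\<close> are \<open>False\<close> almost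
  surely under the two models.
\<close>

type_synonym adjacency = "nat set \<Rightarrow> bool"

definition erdos_renyi :: "nat \<Rightarrow> real \<Rightarrow> adjacency pmf" where
  "erdos_renyi n q = Pi_pmf (complete_edges n) False (\<lambda>_. bernoulli_pmf q)"

definition planted_matching :: "nat \<Rightarrow> real \<Rightarrow> real \<Rightarrow> adjacency pmf" where
  "planted_matching n p l =
     bind_pmf (monomer_dimer (complete_edges n) l)
       (\<lambda>M. Pi_pmf (complete_edges n) False
              (\<lambda>e. if e \<in> M then return_pmf True else bernoulli_pmf p))"

definition signed_edge_count :: "nat \<Rightarrow> real \<Rightarrow> adjacency \<Rightarrow> real" where
  "signed_edge_count n q A = (\<Sum>e\<in>complete_edges n. (of_bool (A e) - q))"

definition expected_matching_size :: "nat \<Rightarrow> real \<Rightarrow> real" where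
  "expected_matching_size n l =
     measure_pmf.expectation (monomer_dimer (complete_edges n) l) (\<lambda>M. real (card M))"

text \<open>
  \<open>RN_deriv Q P\<close> is the derivative of \<open>P\<close> with respect to \<open>Q\<close>: the reference measure
  comes first.
\<close>

definition log_likelihood_ratio :: "'a measure \<Rightarrow> 'a measure \<Rightarrow> 'a \<Rightarrow> real" where
  "log_likelihood_ratio P Q x = ln (enn2real (RN_deriv Q P x))"

definition bounded_in_probability ::
    "(nat \<Rightarrow> 'a measure) \<Rightarrow> (nat \<Rightarrow> 'a \<Rightarrow> real) \<Rightarrow> bool" where
  "bounded_in_probability Q X \<longleftrightarrow>
     (\<forall>\<epsilon>>0. \<exists>C>0. \<forall>\<^sub>F n in sequentially. \<P>(x in Q n. \<bar>X n x\<bar> > C) \<le> \<epsilon>)"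

definition bigO_in_probability ::
    "(nat \<Rightarrow> 'a measure) \<Rightarrow> (nat \<Rightarrow> 'a \<Rightarrow> real) \<Rightarrow> (nat \<Rightarrow> real) \<Rightarrow> bool" where
  "bigO_in_probability Q X a \<longleftrightarrow> bounded_in_probability Q (\<lambda>n x. X n x / a n)"

end

theory Submission
  imports Defs
begin

text \<open>
  The likelihood ratio is expanded in the orthogonal characters \<open>\<Prod>e\<in>S. A e / p - 1\<close>; the
  coefficient of \<open>S\<close> is the probability that the random matching contains \<open>S\<close>. For a matching
  \<open>S\<close> this is close to \<open>\<mu> ^ card S\<close>, where \<open>\<mu>\<close> is the probability of a single edge, because
  the ratios of consecutive partition functions of complete graphs vary slowly. For the other \<open>S\<close>
  it vanishes, and these sets contribute little, since each contains two adjacent edges. By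
  Parseval, the likelihood ratio is within \<open>O(1 / sqrt n)\<close> in \<open>L\<^sup>2\<close> of the product of the factors
  \<open>1 + \<mu> (A e / p - 1)\<close>, whose logarithm is an affine function of the signed edge count.
\<close>

subsection \<open>Characters of a product of Bernoulli laws\<close>

text \<open>Closeness in mean square says nothing about logarithms near 0, so the product is bounded
  below first: its logarithm stays bounded as long as the signed edge count is \<open>O(n)\<close>,
  which by Chebyshev fails only with small probability. The scaling \<open>l \<le> 1 / n\<close>
  keeps the sums over edge sets bounded, because fewer than \<open>n^2\<close> edges enter with a
  squared weight of order \<open>l^2\<close>. The rate is set by the sets with two adjacent edges:
  there are at most \<open>n^3\<close> such pairs, each of squared weight of order
  \<open>n^-4\<close>, so the squared distance is \<open>O(1 / n)\<close>. The coefficients of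
  matchings contribute only order \<open>l^2\<close>, and the logarithm of the product agrees with
  the claimed main term up to \<open>O(1 / n)\<close> on the event above.\<close>

lemma expectation_prod_Pi_pmf_finite:
  fixes f :: "'a \<Rightarrow> 'b \<Rightarrow> real"
  assumes "finite A" and fin: "\<And>x. x \<in> A \<Longrightarrow> finite (set_pmf (P x))"
  shows "measure_pmf.expectation (Pi_pmf A dflt P) (\<lambda>y. \<Prod>x\<in>A. f x (y x)) =
    (\<Prod>x\<in>A. measure_pmf.expectation (P x) (f x))"
proof -
  have fin_Pi: "finite (set_pmf (Pi_pmf A dflt P))"
    using assms by (subst set_Pi_pmf) auto
  have "prob_space.indep_vars (measure_pmf (Pi_pmf A dflt P)) (\<lambda>_. borel) (\<lambda>x y. f x (y x)) A"
    using prob_space.indep_vars_compose2[OF prob_space_measure_pmf indep_vars_Pi_pmf[OF \<open>finite A\<close>],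
        where Y = f and N = "\<lambda>_. borel"] by simp
  then have "measure_pmf.expectation (Pi_pmf A dflt P) (\<lambda>y. \<Prod>x\<in>A. f x (y x)) =
      (\<Prod>x\<in>A. measure_pmf.expectation (Pi_pmf A dflt P) (\<lambda>y. f x (y x)))"
    using assms fin_Pi
    by (intro prob_space.indep_vars_lebesgue_integral prob_space_measure_pmf integrable_measure_pmf_finite)
  also have "\<dots> = (\<Prod>x\<in>A. measure_pmf.expectation (P x) (f x))"
  proof (rule prod.cong)
    fix x assume "x \<in> A"
    then have "P x = map_pmf (\<lambda>y. y x) (Pi_pmf A dflt P)"
      using assms(1) by (simp add: Pi_pmf_component)
    then show "measure_pmf.expectation (Pi_pmf A dflt P) (\<lambda>y. f x (y x)) =
        measure_pmf.expectation (P x) (f x)"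
      by simp
  qed simp
  finally show ?thesis .
qed

definition character :: "real \<Rightarrow> 'e set \<Rightarrow> ('e \<Rightarrow> bool) \<Rightarrow> real" where
  "character p S A = (\<Prod>e\<in>S. of_bool (A e) / p - 1)"

lemma finite_set_pmf_Pi_bernoulli:
  assumes "finite E"
  shows "finite (set_pmf (Pi_pmf E False (\<lambda>_. bernoulli_pmf p)))"
  using assms by (subst set_Pi_pmf) auto

lemma expectation_character_mult:
  assumes "finite E" "S \<subseteq> E" "T \<subseteq> E" and p: "0 < p" "p < 1"
  shows "measure_pmf.expectation (Pi_pmf E False (\<lambda>_. bernoulli_pmf p))
      (\<lambda>A. character p S A * character p T A) =
    (if S = T then ((1 - p) / p) ^ card S else 0)"
proof -
  \<comment> \<open>Both characters become one product over all of \<open>E\<close>, with factor 1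
    off \<open>S\<close> and off \<open>T\<close>, so that the coordinates factorise. The mean of a
    factor is \<open>(1 - p) / p\<close> on \<open>S \<inter> T\<close>, 1 outside
    \<open>S \<union> T\<close>, and 0 on the symmetric difference.\<close>
  define g where "g e b = (if e \<in> S then of_bool b / p - 1 else 1) *
      (if e \<in> T then of_bool b / p - 1 else (1::real))" for e b
  have "character p S A * character p T A = (\<Prod>e\<in>E. g e (A e))" for A
    unfolding character_def g_def prod.distrib
    using assms by (simp add: prod.inter_restrict[symmetric] Int_absorb1)
  then have "measure_pmf.expectation (Pi_pmf E False (\<lambda>_. bernoulli_pmf p))
      (\<lambda>A. character p S A * character p T A) =
      (\<Prod>e\<in>E. measure_pmf.expectation (bernoulli_pmf p) (g e))"
    using \<open>finite E\<close> by (simp add: expectation_prod_Pi_pmf_finite)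
  also have "\<dots> = (\<Prod>e\<in>E. if e \<in> S then if e \<in> T then (1 - p) / p else 0
      else if e \<in> T then 0 else 1)"
    using p by (intro prod.cong refl) (auto simp: g_def field_simps)
  also have "\<dots> = (if S = T then ((1 - p) / p) ^ card S else 0)"
  proof (cases "S = T")
    case True
    have "(\<Prod>e\<in>E. if e \<in> S then (1 - p) / p else 1) = (\<Prod>e\<in>S. (1 - p) / p)"
      using assms by (simp add: prod.inter_restrict[symmetric] Int_absorb1)
    with True show ?thesis by (simp cong: if_cong)
  next
    case False
    then obtain e where "e \<in> E" "(e \<in> S) \<noteq> (e \<in> T)"
      using assms by auto
    then have "\<exists>e\<in>E. (if e \<in> S then if e \<in> T then (1 - p) / p else 0
      else if e \<in> T then 0 else 1) = 0"
      by (intro bexI[of _ e]) auto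
    with False \<open>finite E\<close> show ?thesis by (simp add: prod_zero)
  qed
  finally show ?thesis .
qed

text \<open>Parseval for characters that are orthogonal but not normalised:
  \<open>((1 - p) / p) ^ card S\<close> is the squared norm of \<open>character p S\<close>.\<close>

lemma expectation_character_sum_square:
  assumes "finite E" and p: "0 < p" "p < 1"
  shows "measure_pmf.expectation (Pi_pmf E False (\<lambda>_. bernoulli_pmf p))
      (\<lambda>A. (\<Sum>S\<in>Pow E. d S * character p S A)\<^sup>2) =
    (\<Sum>S\<in>Pow E. (d S)\<^sup>2 * ((1 - p) / p) ^ card S)"
proof -
  have int: "integrable (Pi_pmf E False (\<lambda>_. bernoulli_pmf p)) f"
    for f :: "('a \<Rightarrow> bool) \<Rightarrow> real"
    using assms by (intro integrable_measure_pmf_finite finite_set_pmf_Pi_bernoulli)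
  have "measure_pmf.expectation (Pi_pmf E False (\<lambda>_. bernoulli_pmf p))
      (\<lambda>A. (\<Sum>S\<in>Pow E. d S * character p S A)\<^sup>2) =
    measure_pmf.expectation (Pi_pmf E False (\<lambda>_. bernoulli_pmf p))
      (\<lambda>A. \<Sum>S\<in>Pow E. \<Sum>T\<in>Pow E. d S * d T * (character p S A * character p T A))"
    by (simp add: power2_eq_square sum_product mult_ac)
  also have "\<dots> = (\<Sum>S\<in>Pow E. \<Sum>T\<in>Pow E. d S * d T * (if S = T then ((1 - p) / p) ^ card S else 0))"
    using assms by (simp add: int Bochner_Integration.integral_sum expectation_character_mult)
  also have "\<dots> = (\<Sum>S\<in>Pow E. (d S)\<^sup>2 * ((1 - p) / p) ^ card S)"
    using assms by (simp add: power2_eq_square if_distrib sum.delta' cong: if_cong)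
  finally show ?thesis .
qed

lemma sum_power_card_Pow:
  fixes a :: real
  assumes "finite E"
  shows "(\<Sum>S\<in>Pow E. a ^ card S) = (1 + a) ^ card E"
  using prod_add[OF assms, of "\<lambda>_. a" "\<lambda>_. 1"] by (simp add: add.commute)

text \<open>Removing \<open>T\<close> leaves an arbitrary subset of \<open>E - T\<close>, to which
  the binomial formula applies. It is used with two adjacent edges as \<open>T\<close>.\<close>

lemma sum_power_card_supersets:
  fixes a :: real
  assumes "finite E" "T \<subseteq> E"
  shows "(\<Sum>S | T \<subseteq> S \<and> S \<subseteq> E. a ^ card S) = a ^ card T * (1 + a) ^ card (E - T)"
proof -
  have "(\<Sum>S | T \<subseteq> S \<and> S \<subseteq> E. a ^ card S) = (\<Sum>S\<in>Pow (E - T). a ^ (card T + card S))"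
  proof (rule sum.reindex_bij_witness[where i = "\<lambda>S. T \<union> S" and j = "\<lambda>S. S - T"])
    fix S assume S: "S \<in> {S. T \<subseteq> S \<and> S \<subseteq> E}"
    then have "finite S" "T \<subseteq> S" using assms finite_subset by auto
    then show "a ^ (card T + card (S - T)) = a ^ card S"
      by (metis card_Diff_subset card_mono finite_subset le_add_diff_inverse)
  qed (use assms in auto)
  also have "\<dots> = a ^ card T * (\<Sum>S\<in>Pow (E - T). a ^ card S)"
    by (simp add: power_add sum_distrib_left)
  finally show ?thesis
    using assms by (simp add: sum_power_card_Pow)
qed

subsection \<open>Likelihood ratios of discrete laws\<close>

text \<open>A Radon-Nikodym derivative is determined only almost everywhere, but null sets of a
  discrete law miss its support, so the value at each \<open>x\<close> of positive mass is forced.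
  The inclusion of supports is absolute continuity.\<close>

lemma log_likelihood_ratio_pmf:
  assumes "set_pmf P \<subseteq> set_pmf Q" and "x \<in> set_pmf Q"
  shows "log_likelihood_ratio (measure_pmf P) (measure_pmf Q) x = ln (pmf P x / pmf Q x)"
proof -
  have "density (measure_pmf Q) (\<lambda>x. ennreal (pmf P x / pmf Q x)) = measure_pmf P"
  proof (rule measure_eqI)
    fix A assume "A \<in> sets (density (measure_pmf Q) (\<lambda>x. ennreal (pmf P x / pmf Q x)))"
    have "emeasure (density (measure_pmf Q) (\<lambda>x. ennreal (pmf P x / pmf Q x))) A =
        (\<integral>\<^sup>+x. ennreal (pmf P x / pmf Q x) * indicator A x \<partial>measure_pmf Q)"
      by (simp add: emeasure_density)
    also have "\<dots> = (\<integral>\<^sup>+x. ennreal (pmf P x) * indicator A x \<partial>count_space UNIV)"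
      unfolding nn_integral_measure_pmf
    proof (rule nn_integral_cong)
      fix x
      show "ennreal (pmf Q x) * (ennreal (pmf P x / pmf Q x) * indicator A x) =
          ennreal (pmf P x) * indicator A x"
        using assms(1)
        by (cases "x \<in> set_pmf Q")
          (auto simp: set_pmf_iff ennreal_mult[symmetric] mult.assoc[symmetric])
    qed
    also have "\<dots> = emeasure (measure_pmf P) A"
      by (subst measure_pmf_eq_density) (simp add: emeasure_density)
    finally show "emeasure (density (measure_pmf Q) (\<lambda>x. ennreal (pmf P x / pmf Q x))) A =
      emeasure (measure_pmf P) A" .
  qed simp
  then have "AE x in measure_pmf Q. ennreal (pmf P x / pmf Q x) =
      RN_deriv (measure_pmf Q) (measure_pmf P) x"
    by (intro measure_pmf.RN_deriv_unique) auto
  then have "RN_deriv (measure_pmf Q) (measure_pmf P) x = ennreal (pmf P x / pmf Q x)"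
    using assms(2) by (auto simp: AE_measure_pmf_iff)
  then show ?thesis
    by (simp add: log_likelihood_ratio_def)
qed

subsection \<open>Matchings of complete graphs\<close>

text \<open>Arbitrary vertex sets are allowed because deleting the vertices covered by a matching
  from \<open>{1..n}\<close> need not leave an initial segment.\<close>

definition edges_on :: "'v set \<Rightarrow> 'v set set" where
  "edges_on V = {e. e \<subseteq> V \<and> card e = 2}"

lemma complete_edges_eq: "complete_edges n = edges_on {1..n}"
  by (simp add: complete_edges_def edges_on_def)

lemma finite_edges_on [simp]: "finite V \<Longrightarrow> finite (edges_on V)"
  by (simp add: edges_on_def)

lemma finite_matchings [simp]: "finite E \<Longrightarrow> finite (matchings E)"
  by (simp add: matchings_def)

lemma finite_matching: "finite E \<Longrightarrow> M \<in> matchings E \<Longrightarrow> finite M"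
  by (auto simp: matchings_def intro: finite_subset)

text \<open>Removing \<open>S\<close> is a bijection onto the matchings of the complete graph on the
  vertices that \<open>S\<close> does not cover.\<close>

lemma sum_matchings_supersets:
  fixes l :: real
  assumes "finite V" and S: "S \<in> matchings (edges_on V)"
  shows "(\<Sum>M | M \<in> matchings (edges_on V) \<and> S \<subseteq> M. l ^ card M) =
    l ^ card S * matching_Z (edges_on (V - \<Union>S)) l"
proof -
  have "finite S"
    using finite_matching[OF _ S] \<open>finite V\<close> by simp
  have "(\<Sum>M | M \<in> matchings (edges_on V) \<and> S \<subseteq> M. l ^ card M) =
      (\<Sum>M\<in>matchings (edges_on (V - \<Union>S)). l ^ card S * l ^ card M)"
  proof (rule sum.reindex_bij_witness[where i = "\<lambda>M. S \<union> M" and j = "\<lambda>M. M - S"])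
    fix M assume M: "M \<in> {M. M \<in> matchings (edges_on V) \<and> S \<subseteq> M}"
    then have "finite M" "S \<subseteq> M"
      using finite_matching[of "edges_on V" M] \<open>finite V\<close> by simp_all
    then show "l ^ card S * l ^ card (M - S) = l ^ card M"
      using \<open>finite S\<close> by (metis card_Diff_subset card_mono le_add_diff_inverse power_add)
    show "S \<union> (M - S) = M" using M by auto
    have "pairwise disjnt M" using M by (simp add: matchings_def)
    then have "e \<inter> s = {}" if "e \<in> M - S" "s \<in> S" for e s
      using that \<open>S \<subseteq> M\<close> pairwiseD[OF \<open>pairwise disjnt M\<close>, of e s] by (auto simp: disjnt_def)
    then have "e \<subseteq> V - \<Union>S" if "e \<in> M - S" for e
      using that M by (fastforce simp: matchings_def edges_on_def)
    then show "M - S \<in> matchings (edges_on (V - \<Union>S))"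
      using M by (auto simp: matchings_def edges_on_def pairwise_def)
  next
    fix M assume M: "M \<in> matchings (edges_on (V - \<Union>S))"
    have disj: "e \<inter> s = {}" if "e \<in> M" "s \<in> S" for e s
      using that M by (fastforce simp: matchings_def edges_on_def)
    \<comment> \<open>Disjointness of edges rules out a common member of \<open>S\<close> and
      \<open>M\<close> because edges are nonempty.\<close>
    have "e \<noteq> {}" if "e \<in> M" for e
      using that M by (auto simp: matchings_def edges_on_def)
    then have "S \<inter> M = {}" using disj by blast
    then show "(S \<union> M) - S = M" by auto
    have "pairwise disjnt S" "pairwise disjnt M" using S M by (auto simp: matchings_def)
    then have "pairwise disjnt (S \<union> M)"
      using disj unfolding pairwise_def disjnt_def by (metis Int_commute UnE)
    then show "S \<union> M \<in> {M. M \<in> matchings (edges_on V) \<and> S \<subseteq> M}"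
      using S M by (auto simp: matchings_def edges_on_def)
  qed
  then show ?thesis
    by (simp add: matching_Z_def sum_distrib_left)
qed

text \<open>The matching polynomial of the complete graph on \<open>n\<close> vertices, a rescaled
  Hermite polynomial. In the recursion a fixed vertex is unmatched or paired with one of the
  \<open>Suc n\<close> others.\<close>

fun clique_Z :: "real \<Rightarrow> nat \<Rightarrow> real" where
  "clique_Z l 0 = 1"
| "clique_Z l (Suc 0) = 1"
| "clique_Z l (Suc (Suc n)) = clique_Z l (Suc n) + real (Suc n) * l * clique_Z l n"

lemma clique_Z_pos: "0 \<le> l \<Longrightarrow> 0 < clique_Z l n"
  by (induction l n rule: clique_Z.induct) (auto intro!: add_pos_nonneg)

text \<open>A fixed vertex \<open>v\<close> is either uncovered or joined to exactly one
  \<open>w\<close>, which is the recursion of \<open>clique_Z\<close>. The induction is strong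
  because the second case deletes two vertices.\<close>

lemma matching_Z_edges_on:
  assumes "finite V"
  shows "matching_Z (edges_on V) l = clique_Z l (card V)"
  using assms
proof (induction "card V" arbitrary: V rule: less_induct)
  case less
  show ?case
  proof (cases "V = {}")
    case True
    then have "edges_on V = {}" by (auto simp: edges_on_def)
    then have "matchings (edges_on V) = {{}}" by (auto simp: matchings_def)
    then show ?thesis using True by (simp add: matching_Z_def)
  next
    case False
    then obtain v where v: "v \<in> V" by auto
    define W where "W = V - {v}"
    have W: "finite W" "v \<notin> W" "V = insert v W" using v less.prems by (auto simp: W_def)
    define matched where "matched w = {M. M \<in> matchings (edges_on V) \<and> {{v, w}} \<subseteq> M}" for w
    have fin: "finite (matchings (edges_on V))" using less.prems by simp
    have "matchings (edges_on V) = matchings (edges_on W) \<union> (\<Union>w\<in>W. matched w)"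
    proof (intro equalityI subsetI)
      fix M assume M: "M \<in> matchings (edges_on V)"
      show "M \<in> matchings (edges_on W) \<union> (\<Union>w\<in>W. matched w)"
      proof (cases "v \<in> \<Union>M")
        case True
        then obtain e where e: "e \<in> M" "v \<in> e" by auto
        then have "e \<subseteq> V" "card e = 2" using M by (auto simp: matchings_def edges_on_def)
        then obtain w where "e = {v, w}" "w \<noteq> v"
          using e(2) by (auto simp: card_2_iff)
        then have "w \<in> W" "M \<in> matched w"
          using e M \<open>e \<subseteq> V\<close> by (auto simp: W_def matched_def)
        then show ?thesis by auto
      next
        case False
        then have "M \<in> matchings (edges_on W)"
          using M by (auto simp: matchings_def edges_on_def W_def)
        then show ?thesis by auto
      qed
    qed (auto simp: matchings_def edges_on_def W_def matched_def)
    moreover have "matchings (edges_on W) \<inter> (\<Union>w\<in>W. matched w) = {}"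
      by (auto simp: matchings_def edges_on_def W_def matched_def)
    moreover have "finite (matchings (edges_on W))" using W by simp
    moreover have fin_matched: "finite (matched w)" for w
      using fin by (simp add: matched_def)
    ultimately have "matching_Z (edges_on V) l =
        matching_Z (edges_on W) l + (\<Sum>M\<in>(\<Union>w\<in>W. matched w). l ^ card M)"
      using W(1) unfolding matching_Z_def by (simp add: sum.union_disjoint)
    also have "(\<Sum>M\<in>(\<Union>w\<in>W. matched w). l ^ card M) = (\<Sum>w\<in>W. \<Sum>M\<in>matched w. l ^ card M)"
    proof (rule sum.UNION_disjoint)
      show "\<forall>w\<in>W. \<forall>w'\<in>W. w \<noteq> w' \<longrightarrow> matched w \<inter> matched w' = {}"
      proof (intro ballI impI)
        fix w w' assume *: "w \<in> W" "w' \<in> W" "w \<noteq> w'"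
        have False if M: "M \<in> matched w \<inter> matched w'" for M
        proof -
          have "pairwise disjnt M" "{v, w} \<in> M" "{v, w'} \<in> M"
            using M by (auto simp: matched_def matchings_def)
          moreover have "{v, w} \<noteq> {v, w'}" using * by (auto simp: doubleton_eq_iff)
          ultimately show False
            using pairwiseD[of disjnt M "{v, w}" "{v, w'}"] by (simp add: disjnt_def)
        qed
        then show "matched w \<inter> matched w' = {}" by blast
      qed
    qed (use W fin_matched in auto)
    also have "\<dots> = (\<Sum>w\<in>W. l * clique_Z l (card V - 2))"
    proof (rule sum.cong)
      fix w assume w: "w \<in> W"
      then have "v \<noteq> w" using W by auto
      then have card: "card {v, w} = 2" by simp
      then have "{{v, w}} \<in> matchings (edges_on V)"
        using w v by (auto simp: matchings_def edges_on_def W_def)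
      then have "(\<Sum>M\<in>matched w. l ^ card M) = l * matching_Z (edges_on (V - {v, w})) l"
        unfolding matched_def using less.prems by (subst sum_matchings_supersets) auto
      moreover have "card (V - {v, w}) = card V - 2"
        using w v card less.prems by (subst card_Diff_subset) (auto simp: W_def)
      moreover have "card V > 0"
        using v less.prems by (auto simp: card_gt_0_iff)
      ultimately show "(\<Sum>M\<in>matched w. l ^ card M) = l * clique_Z l (card V - 2)"
        using less.hyps[of "V - {v, w}"] less.prems by simp
    qed simp
    also have "matching_Z (edges_on W) l = clique_Z l (card W)"
      using W by (intro less.hyps) auto
    finally have "matching_Z (edges_on V) l =
        clique_Z l (card W) + card W * l * clique_Z l (card W - 1)"
      using W by simp
    \<comment> \<open>If \<open>W\<close> is empty, the factor \<open>card W\<close> removes the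
      term with the truncated index \<open>card W - 1\<close>.\<close>
    then show ?thesis
      using W by (cases "card W") auto
  qed
qed

subsection \<open>Inclusion probabilities and the likelihood ratio\<close>

definition inclusion_prob :: "'v set set \<Rightarrow> real \<Rightarrow> 'v set set \<Rightarrow> real" where
  "inclusion_prob E l S = (\<Sum>M | M \<in> matchings E \<and> S \<subseteq> M. l ^ card M) / matching_Z E l"

lemma inclusion_prob_not_matching:
  assumes "S \<notin> matchings E"
  shows "inclusion_prob E l S = 0"
proof -
  have "{M. M \<in> matchings E \<and> S \<subseteq> M} = {}"
    using assms by (auto simp: matchings_def intro: pairwise_mono)
  then show ?thesis by (simp only: inclusion_prob_def) simp
qed

lemma card_Union_matching:
  assumes "finite V" "S \<in> matchings (edges_on V)"
  shows "card (\<Union>S) = 2 * card S"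
proof -
  have "card (\<Union>S) = sum card S"
    using assms by (intro card_Union_disjoint)
      (auto simp: matchings_def edges_on_def intro: finite_subset)
  also have "\<dots> = (\<Sum>e\<in>S. 2)"
    using assms by (intro sum.cong) (auto simp: matchings_def edges_on_def)
  finally show ?thesis by simp
qed

text \<open>A matching of \<open>k\<close> edges covers \<open>2 * k\<close> vertices and leaves a
  complete graph on the others, so only \<open>k\<close> matters. The first conclusion makes the
  subtraction in the second a genuine one.\<close>

lemma inclusion_prob_matching:
  assumes "finite V" and S: "S \<in> matchings (edges_on V)"
  shows "2 * card S \<le> card V"
    and "inclusion_prob (edges_on V) l S =
      l ^ card S * clique_Z l (card V - 2 * card S) / clique_Z l (card V)"
proof -
  have sub: "\<Union>S \<subseteq> V"
    using S by (auto simp: matchings_def edges_on_def)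
  show "2 * card S \<le> card V"
    using card_mono[OF \<open>finite V\<close> sub] card_Union_matching[OF assms] by simp
  have "card (V - \<Union>S) = card V - 2 * card S"
    using sub \<open>finite V\<close> card_Union_matching[OF assms]
    by (subst card_Diff_subset) (auto intro: finite_subset)
  then show "inclusion_prob (edges_on V) l S =
      l ^ card S * clique_Z l (card V - 2 * card S) / clique_Z l (card V)"
    using assms by (simp add: inclusion_prob_def sum_matchings_supersets matching_Z_edges_on)
qed

text \<open>Linearity of expectation: \<open>card M\<close> counts the edges \<open>e\<close> with
  \<open>{e} \<subseteq> M\<close>, and the two sums are exchanged.\<close>

lemma expectation_card_monomer_dimer:
  assumes "finite E" "0 < l"
  shows "measure_pmf.expectation (monomer_dimer E l) (\<lambda>M. real (card M)) =
    (\<Sum>e\<in>E. inclusion_prob E l {e})"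
proof -
  have "measure_pmf.expectation (monomer_dimer E l) (\<lambda>M. real (card M)) =
      (\<Sum>M\<in>matchings E. real (card M) * (l ^ card M / matching_Z E l))"
    using assms by (subst integral_measure_pmf_real[where A = "matchings E"])
      (auto simp: pmf_monomer_dimer set_pmf_iff split: if_splits)
  also have "\<dots> = (\<Sum>M\<in>matchings E. \<Sum>e | e \<in> E \<and> {e} \<subseteq> M. l ^ card M / matching_Z E l)"
  proof (rule sum.cong)
    fix M assume "M \<in> matchings E"
    then have "{e. e \<in> E \<and> {e} \<subseteq> M} = M" by (auto simp: matchings_def)
    then show "real (card M) * (l ^ card M / matching_Z E l) =
        (\<Sum>e | e \<in> E \<and> {e} \<subseteq> M. l ^ card M / matching_Z E l)"
      by simp
  qed simp
  also have "\<dots> = (\<Sum>e\<in>E. \<Sum>M | M \<in> matchings E \<and> {e} \<subseteq> M. l ^ card M / matching_Z E l)"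
    using assms by (intro sum.swap_restrict) auto
  finally show ?thesis
    by (simp add: inclusion_prob_def sum_divide_distrib)
qed

text \<open>Planting a fixed \<open>M\<close> multiplies the mass of \<open>A\<close> by the product
  of \<open>A e / p\<close> over \<open>e \<in> M\<close>. Each factor is 1 plus a character of one
  edge, so the product expands into the characters of all \<open>S \<subseteq> M\<close>; averaging
  over \<open>M\<close> gives \<open>S\<close> its inclusion probability.\<close>

lemma likelihood_ratio_planted_matching:
  fixes n :: nat
  defines "E \<equiv> complete_edges n"
  assumes p: "0 < p" "p < 1" and "0 < l" and A: "A \<in> set_pmf (erdos_renyi n p)"
  shows "pmf (planted_matching n p l) A / pmf (erdos_renyi n p) A =
    (\<Sum>S\<in>Pow E. inclusion_prob E l S * character p S A)"
proof -
  have fin: "finite E" by (simp add: E_def complete_edges_eq)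
  have out: "A e = False" if "e \<notin> E" for e
    using subsetD[OF set_Pi_pmf_subset[OF fin] A[unfolded erdos_renyi_def E_def[symmetric]]] that
    by simp
  define w where "w M = l ^ card M / matching_Z E l" for M :: "nat set set"
  have ratio: "pmf (Pi_pmf E False (\<lambda>e. if e \<in> M then return_pmf True else bernoulli_pmf p)) A =
      pmf (erdos_renyi n p) A * (\<Sum>S\<in>Pow M. character p S A)" if M: "M \<in> matchings E" for M
  proof -
    have "M \<subseteq> E" "finite M"
      using M fin by (auto simp: matchings_def intro: finite_subset)
    have "pmf (Pi_pmf E False (\<lambda>e. if e \<in> M then return_pmf True else bernoulli_pmf p)) A =
        (\<Prod>e\<in>E. pmf (if e \<in> M then return_pmf True else bernoulli_pmf p) (A e))"
      using fin out by (simp add: pmf_Pi')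
    \<comment> \<open>On a planted edge the mass is 1 or 0 according to \<open>A e\<close>, which is
      the Bernoulli mass times \<open>of_bool (A e) / p\<close>.\<close>
    also have "\<dots> = (\<Prod>e\<in>E. pmf (bernoulli_pmf p) (A e) * (if e \<in> M then of_bool (A e) / p else 1))"
      using p by (intro prod.cong) auto
    also have "\<dots> = pmf (erdos_renyi n p) A * (\<Prod>e\<in>M. of_bool (A e) / p)"
      using fin out \<open>M \<subseteq> E\<close> unfolding erdos_renyi_def E_def[symmetric]
      by (simp add: prod.distrib pmf_Pi' prod.inter_restrict[symmetric] Int_absorb1)
    also have "(\<Prod>e\<in>M. of_bool (A e) / p) = (\<Prod>e\<in>M. (of_bool (A e) / p - 1) + 1)"
      by simp
    also have "\<dots> = (\<Sum>S\<in>Pow M. character p S A)"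
      using prod_add[OF \<open>finite M\<close>, of "\<lambda>e. of_bool (A e) / p - 1" "\<lambda>_. 1"]
      by (simp add: character_def)
    finally show ?thesis .
  qed
  have "pmf (planted_matching n p l) A = (\<Sum>M\<in>matchings E.
      pmf (Pi_pmf E False (\<lambda>e. if e \<in> M then return_pmf True else bernoulli_pmf p)) A * w M)"
    unfolding planted_matching_def pmf_bind E_def[symmetric]
    using fin \<open>0 < l\<close> by (subst integral_measure_pmf_real[where A = "matchings E"])
      (auto simp: pmf_monomer_dimer set_pmf_iff w_def split: if_splits)
  also have "\<dots> = (\<Sum>M\<in>matchings E.
      pmf (erdos_renyi n p) A * ((\<Sum>S | S \<in> Pow E \<and> S \<subseteq> M. w M * character p S A)))"
  proof (rule sum.cong)
    fix M assume M: "M \<in> matchings E"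
    then have "{S. S \<in> Pow E \<and> S \<subseteq> M} = Pow M" by (auto simp: matchings_def)
    then show "pmf (Pi_pmf E False (\<lambda>e. if e \<in> M then return_pmf True else bernoulli_pmf p)) A * w M =
        pmf (erdos_renyi n p) A * (\<Sum>S | S \<in> Pow E \<and> S \<subseteq> M. w M * character p S A)"
      using ratio[OF M] by (simp add: sum_distrib_left mult_ac)
  qed simp
  also have "\<dots> = pmf (erdos_renyi n p) A *
      (\<Sum>M\<in>matchings E. \<Sum>S | S \<in> Pow E \<and> S \<subseteq> M. w M * character p S A)"
    by (simp add: sum_distrib_left)
  also have "(\<Sum>M\<in>matchings E. \<Sum>S | S \<in> Pow E \<and> S \<subseteq> M. w M * character p S A) =
      (\<Sum>S\<in>Pow E. \<Sum>M | M \<in> matchings E \<and> S \<subseteq> M. w M * character p S A)"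
    using fin by (intro sum.swap_restrict) auto
  also have "\<dots> = (\<Sum>S\<in>Pow E. inclusion_prob E l S * character p S A)"
    by (simp add: inclusion_prob_def w_def sum_divide_distrib sum_distrib_right)
  finally show ?thesis
    using A by (simp add: set_pmf_iff)
qed

text \<open>Since \<open>0 < p < 1\<close>, every adjacency that vanishes outside
  \<open>complete_edges n\<close> has positive mass under the null model. This supplies the absolute
  continuity.\<close>

lemma set_pmf_planted_matching_subset:
  assumes p: "0 < p" "p < 1"
  shows "set_pmf (planted_matching n p l) \<subseteq> set_pmf (erdos_renyi n p)"
proof -
  have "finite (complete_edges n)" by (simp add: complete_edges_eq)
  moreover from this have "set_pmf (erdos_renyi n p) = PiE_dflt (complete_edges n) False (\<lambda>_. UNIV)"
    using p by (simp add: erdos_renyi_def set_Pi_pmf comp_def UNIV_bool)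
  ultimately show ?thesis
    by (auto simp: planted_matching_def set_Pi_pmf PiE_dflt_def)
qed

subsection \<open>Ratios of partition functions\<close>

text \<open>The probability that a given vertex of the complete graph on \<open>Suc j\<close>
  vertices is left unmatched.\<close>

definition clique_ratio :: "real \<Rightarrow> nat \<Rightarrow> real" where
  "clique_ratio l j = clique_Z l j / clique_Z l (Suc j)"

text \<open>Dividing the recursion of \<open>clique_Z\<close> by \<open>clique_Z l (Suc j)\<close>
  gives one step of a continued fraction.\<close>

lemma clique_ratio_Suc:
  assumes "0 \<le> l"
  shows "clique_ratio l (Suc j) = 1 / (1 + real (Suc j) * l * clique_ratio l j)"
  using clique_Z_pos[OF assms, of j] clique_Z_pos[OF assms, of "Suc j"]
    clique_Z_pos[OF assms, of "Suc (Suc j)"]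
  by (simp add: clique_ratio_def field_simps)

lemma clique_ratio_bounds:
  assumes "0 \<le> l"
  shows "0 \<le> clique_ratio l j" "clique_ratio l j \<le> 1"
proof -
  show nonneg: "0 \<le> clique_ratio l j" for j
    using clique_Z_pos[OF assms] by (simp add: clique_ratio_def less_imp_le)
  show "clique_ratio l j \<le> 1"
  proof (cases j)
    case 0
    then show ?thesis by (simp add: clique_ratio_def)
  next
    case (Suc i)
    have "0 \<le> real (Suc i) * l * clique_ratio l i"
      using assms nonneg by simp
    then show ?thesis
      unfolding Suc clique_ratio_Suc[OF assms] by simp
  qed
qed

text \<open>The recursion for the ratios is a contraction with factor \<open>1 / 2\<close>.\<close>

lemma clique_ratio_step:
  assumes "0 \<le> l" "real (Suc j) * l \<le> 1 / 2"
  shows "\<bar>clique_ratio l (Suc j) - clique_ratio l j\<bar> \<le> 2 * l"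
  using assms(2)
proof (induction j)
  case 0
  have "\<bar>1 / (1 + l) - 1\<bar> \<le> 2 * l"
    using \<open>0 \<le> l\<close> by (simp add: field_simps)
  then show ?case
    using clique_ratio_Suc[OF \<open>0 \<le> l\<close>, of 0] by (simp add: clique_ratio_def)
next
  case (Suc j)
  define u v w where "u = clique_ratio l j" and "v = clique_ratio l (Suc j)"
    and "w = clique_ratio l (Suc (Suc j))"
  define c where "c = real (Suc j) * l"
  have bounds: "0 \<le> u" "0 \<le> v" "v \<le> 1" "0 \<le> w" "w \<le> 1"
    using clique_ratio_bounds[OF \<open>0 \<le> l\<close>] by (simp_all add: u_def v_def w_def)
  have c: "0 \<le> c" "c \<le> 1 / 2"
    using \<open>0 \<le> l\<close> Suc.prems by (simp_all add: c_def algebra_simps)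
  have IH: "\<bar>v - u\<bar> \<le> 2 * l"
    using Suc.IH c by (simp add: u_def v_def c_def)
  have v: "v = 1 / (1 + c * u)"
    unfolding v_def u_def c_def by (rule clique_ratio_Suc[OF \<open>0 \<le> l\<close>])
  have "w = 1 / (1 + real (Suc (Suc j)) * l * v)"
    unfolding v_def w_def by (rule clique_ratio_Suc[OF \<open>0 \<le> l\<close>])
  also have "real (Suc (Suc j)) * l = c + l"
    by (simp add: c_def algebra_simps)
  finally have w: "w = 1 / (1 + (c + l) * v)" .
  have "0 < 1 + c * u" "0 < 1 + (c + l) * v"
    using bounds c \<open>0 \<le> l\<close> by (simp_all add: add_pos_nonneg)
  \<comment> \<open>The bracket is \<open>1 / v - 1 / w\<close>. The previous difference is damped
    by \<open>c \<le> 1 / 2\<close>, and the growth of the coefficient from \<open>c\<close> to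
    \<open>c + l\<close> adds at most \<open>l\<close>; the bound \<open>2 * l\<close> is the
    solution of \<open>x = x / 2 + l\<close>.\<close>
  then have "w - v = w * v * (c * (u - v) - l * v)"
    unfolding w by (subst (1 3) v) (simp add: field_simps)
  then have "\<bar>w - v\<bar> = (w * v) * \<bar>c * (u - v) - l * v\<bar>"
    using bounds by (simp add: abs_mult)
  also have "\<dots> \<le> 1 * \<bar>c * (u - v) - l * v\<bar>"
    using bounds by (intro mult_right_mono mult_le_one) auto
  also have "\<dots> \<le> \<bar>c * (u - v)\<bar> + \<bar>l * v\<bar>"
    by simp
  also have "\<bar>c * (u - v)\<bar> \<le> 1 / 2 * (2 * l)"
    using c IH unfolding abs_mult by (intro mult_mono) auto
  also have "\<bar>l * v\<bar> \<le> l"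
    using bounds \<open>0 \<le> l\<close> by (simp add: abs_mult mult_left_le)
  finally show ?case
    by (simp add: v_def w_def)
qed

lemma clique_ratio_lipschitz:
  assumes "0 \<le> l" "real (j + d) * l \<le> 1 / 2"
  shows "\<bar>clique_ratio l (j + d) - clique_ratio l j\<bar> \<le> 2 * l * real d"
  using assms(2)
proof (induction d)
  case (Suc d)
  have "real (j + d) * l \<le> real (j + Suc d) * l"
    using \<open>0 \<le> l\<close> by (intro mult_right_mono) auto
  then have "\<bar>clique_ratio l (j + d) - clique_ratio l j\<bar> \<le> 2 * l * real d"
    using Suc by linarith
  moreover have "\<bar>clique_ratio l (Suc (j + d)) - clique_ratio l (j + d)\<bar> \<le> 2 * l"
    using Suc.prems \<open>0 \<le> l\<close> by (intro clique_ratio_step) auto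
  ultimately show ?case
    by (simp add: algebra_simps)
qed simp

text \<open>The difference is split through \<open>a * d\<close>, so bounds on one factor of each
  product suffice.\<close>

lemma abs_mult_diff_le:
  fixes a b c d :: real
  assumes "0 \<le> a" "a \<le> 1" "0 \<le> d" "d \<le> 1"
  shows "\<bar>a * b - c * d\<bar> \<le> \<bar>b - d\<bar> + \<bar>a - c\<bar>"
proof -
  have "\<bar>a * b - c * d\<bar> = \<bar>a * (b - d) + (a - c) * d\<bar>"
    by (simp add: algebra_simps)
  also have "\<dots> \<le> a * \<bar>b - d\<bar> + \<bar>a - c\<bar> * d"
    using assms by (metis abs_mult abs_of_nonneg abs_triangle_ineq)
  also have "\<dots> \<le> \<bar>b - d\<bar> + \<bar>a - c\<bar>"
    using assms by (intro add_mono mult_left_le_one_le mult_right_le_one_le) auto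
  finally show ?thesis .
qed

lemma clique_Z_quotient_two:
  assumes "0 \<le> l"
  shows "clique_Z l m / clique_Z l (Suc (Suc m)) = clique_ratio l m * clique_ratio l (Suc m)"
  using clique_Z_pos[OF assms, of "Suc m"] by (simp add: clique_ratio_def del: clique_Z.simps)

lemma clique_Z_quotient_bounds:
  assumes "0 \<le> l"
  shows "0 \<le> clique_Z l (n - 2) / clique_Z l n" "clique_Z l (n - 2) / clique_Z l n \<le> 1"
proof -
  show "0 \<le> clique_Z l (n - 2) / clique_Z l n"
    using clique_Z_pos[OF assms] by (simp add: less_imp_le)
  show "clique_Z l (n - 2) / clique_Z l n \<le> 1"
  \<comment> \<open>For \<open>n = 0\<close> and \<open>n = 1\<close> the truncated index
    \<open>n - 2\<close> is 0 and the quotient equals 1.\<close>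
  proof (cases "n < 2")
    case True
    then have "n = 0 \<or> n = Suc 0" by auto
    then show ?thesis by auto
  next
    case False
    then obtain m where "n = Suc (Suc m)"
      by (metis add_2_eq_Suc le_add_diff_inverse not_less)
    then show ?thesis
      using clique_Z_quotient_two[OF assms, of m] clique_ratio_bounds[OF assms]
      by (simp add: mult_le_one del: clique_Z.simps)
  qed
qed

text \<open>The quotient telescopes into \<open>k\<close> two-step quotients, each compared with the
  topmost one. The one that lies \<open>2 * j\<close> indices lower differs from it by at most
  \<open>8 * j * l\<close>, and these errors add up to at most \<open>8 * k^2 * l\<close>, as all
  factors lie in the unit interval.\<close>

lemma clique_Z_quotient_approx_power:
  assumes "0 \<le> l" "real n * l \<le> 1 / 2" "2 * k \<le> n"
  shows "\<bar>clique_Z l (n - 2 * k) / clique_Z l n - (clique_Z l (n - 2) / clique_Z l n) ^ k\<bar>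
    \<le> 8 * (real k)\<^sup>2 * l"
  using assms(3)
proof (induction k)
  case 0
  then show ?case
    using clique_Z_pos[OF \<open>0 \<le> l\<close>, of n] by simp
next
  case (Suc k)
  define m where "m = n - 2 * Suc k"
  have n: "n = Suc (Suc (m + 2 * k))" and n2: "n - 2 * k = Suc (Suc m)"
    using Suc.prems by (auto simp: m_def)
  define \<rho> where "\<rho> = clique_ratio l"
  have \<rho>: "0 \<le> \<rho> j" "\<rho> j \<le> 1" for j
    using clique_ratio_bounds[OF \<open>0 \<le> l\<close>] by (simp_all add: \<rho>_def)
  define \<theta> s R where "\<theta> = clique_Z l (n - 2) / clique_Z l n"
    and "s = clique_Z l m / clique_Z l (n - 2 * k)"
    and "R = clique_Z l (n - 2 * k) / clique_Z l n"
  have \<theta>: "\<theta> = \<rho> (m + 2 * k) * \<rho> (Suc (m + 2 * k))"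
    unfolding \<theta>_def \<rho>_def clique_Z_quotient_two[OF \<open>0 \<le> l\<close>, symmetric] n by simp
  have s: "s = \<rho> m * \<rho> (Suc m)"
    unfolding s_def \<rho>_def clique_Z_quotient_two[OF \<open>0 \<le> l\<close>, symmetric] n2 by simp
  have \<theta>_bounds: "0 \<le> \<theta>" "\<theta> \<le> 1" "0 \<le> s" "s \<le> 1"
    using \<rho> by (simp_all add: \<theta> s mult_le_one)
  have le: "real j * l \<le> 1 / 2" if "j \<le> n" for j
    using that assms(1,2) by (meson mult_right_mono of_nat_mono order_trans)
  have "\<bar>s - \<theta>\<bar> = \<bar>\<rho> (m + 2 * k) * \<rho> (Suc m + 2 * k) - \<rho> m * \<rho> (Suc m)\<bar>"
    by (simp add: \<theta> s)
  also have "\<dots> \<le> \<bar>\<rho> (Suc m + 2 * k) - \<rho> (Suc m)\<bar> + \<bar>\<rho> (m + 2 * k) - \<rho> m\<bar>"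
    using \<rho> by (intro abs_mult_diff_le)
  \<comment> \<open>Each of the two ratios is shifted by \<open>2 * k\<close> indices and drifts by
    at most \<open>2 * l\<close> per index.\<close>
  also have "\<dots> \<le> 2 * l * real (2 * k) + 2 * l * real (2 * k)"
    unfolding \<rho>_def using n by (intro add_mono clique_ratio_lipschitz le assms) auto
  finally have step: "\<bar>s - \<theta>\<bar> \<le> 8 * real k * l"
    by (simp add: mult_ac)
  have "clique_Z l (n - 2 * Suc k) / clique_Z l n = s * R"
    using clique_Z_pos[OF \<open>0 \<le> l\<close>, of "n - 2 * k"] by (simp add: s_def R_def m_def)
  then have "\<bar>clique_Z l (n - 2 * Suc k) / clique_Z l n - \<theta> ^ Suc k\<bar> = \<bar>s * R - \<theta> * \<theta> ^ k\<bar>"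
    by simp
  also have "\<dots> \<le> \<bar>R - \<theta> ^ k\<bar> + \<bar>s - \<theta>\<bar>"
    using \<theta>_bounds by (intro abs_mult_diff_le) (auto intro: power_le_one)
  also have "\<dots> \<le> 8 * (real k)\<^sup>2 * l + 8 * real k * l"
    using Suc step by (intro add_mono) (auto simp: R_def \<theta>_def)
  also have "\<dots> \<le> 8 * (real (Suc k))\<^sup>2 * l"
    using \<open>0 \<le> l\<close> by (simp add: power2_eq_square algebra_simps)
  finally show ?case
    by (simp add: \<theta>_def)
qed

subsection \<open>Distance to the product approximation\<close>

lemma sum_UN_le:
  fixes f :: "'a \<Rightarrow> real"
  assumes "finite I" "\<And>i. i \<in> I \<Longrightarrow> finite (A i)" "\<And>x. 0 \<le> f x"
  shows "sum f (\<Union>i\<in>I. A i) \<le> (\<Sum>i\<in>I. sum f (A i))"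
  using assms(1,2)
proof (induction I rule: finite_induct)
  case (insert i I)
  then have "sum f (A i \<union> (\<Union>i\<in>I. A i)) + sum f (A i \<inter> (\<Union>i\<in>I. A i)) =
      sum f (A i) + sum f (\<Union>i\<in>I. A i)"
    by (intro sum.union_inter) auto
  moreover have "0 \<le> sum f (A i \<inter> (\<Union>i\<in>I. A i))"
    using assms(3) by (intro sum_nonneg)
  ultimately show ?case
    using insert by auto
qed simp

lemma one_plus_power_le_exp:
  fixes a :: real
  assumes "0 \<le> a"
  shows "(1 + a) ^ m \<le> exp (real m * a)"
  using assms by (simp add: exp_of_nat_mult power_mono)

text \<open>A union bound over paths of two edges: each is given by a triple of vertices, and the
  sets that contain it have total weight at most \<open>a^2 * (1 + a) ^ card E\<close>. For
  \<open>a\<close> of order \<open>n^-2\<close> the result is of order \<open>1 / n\<close>.\<close>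

lemma sum_power_card_not_matching_le:
  fixes a :: real
  assumes "finite V" "0 \<le> a"
  defines "E \<equiv> edges_on V"
  shows "(\<Sum>S\<in>Pow E - matchings E. a ^ card S) \<le> real (card V) ^ 3 * a\<^sup>2 * exp (real (card E) * a)"
proof -
  have fin: "finite E" using assms by (simp add: E_def)
  \<comment> \<open>Here \<open>x\<close> is the common endpoint; the last condition ensures that
    \<open>T\<close> yields exactly two edges, hence the factor \<open>a^2\<close>.\<close>
  define I where "I = {(x, y, z). x \<in> V \<and> y \<in> V \<and> z \<in> V \<and> {x, y} \<in> E \<and> {x, z} \<in> E \<and> {x, y} \<noteq> {x, z}}"
  define T where "T = (\<lambda>(x, y, z). {{x, y}, {x, z :: 'a}})"
  have I_sub: "I \<subseteq> V \<times> V \<times> V" by (auto simp: I_def)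
  then have finI: "finite I" using \<open>finite V\<close> finite_subset by blast
  have "card I \<le> card (V \<times> V \<times> V)"
    using I_sub \<open>finite V\<close> by (intro card_mono) auto
  then have cardI: "card I \<le> card V ^ 3"
    by (simp add: card_cartesian_product power3_eq_cube)
  have "Pow E - matchings E \<subseteq> (\<Union>i\<in>I. {S. T i \<subseteq> S \<and> S \<subseteq> E})"
  proof
    fix S assume S: "S \<in> Pow E - matchings E"
    then obtain e f where ef: "e \<in> S" "f \<in> S" "e \<noteq> f" "\<not> disjnt e f"
      by (auto simp: matchings_def pairwise_def)
    then obtain x where x: "x \<in> e" "x \<in> f" by (auto simp: disjnt_def)
    have "e \<subseteq> V" "card e = 2" "f \<subseteq> V" "card f = 2"
      using S ef by (auto simp: E_def edges_on_def)
    then obtain y z where yz: "e = {x, y}" "f = {x, z}"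
      using x by (auto simp: card_2_iff)
    have "(x, y, z) \<in> I"
      using S ef yz \<open>e \<subseteq> V\<close> \<open>f \<subseteq> V\<close> by (auto simp: I_def)
    moreover have "T (x, y, z) \<subseteq> S" using ef yz by (simp add: T_def)
    ultimately show "S \<in> (\<Union>i\<in>I. {S. T i \<subseteq> S \<and> S \<subseteq> E})" using S by blast
  qed
  then have "(\<Sum>S\<in>Pow E - matchings E. a ^ card S) \<le>
      (\<Sum>S\<in>(\<Union>i\<in>I. {S. T i \<subseteq> S \<and> S \<subseteq> E}). a ^ card S)"
    using fin finI \<open>0 \<le> a\<close> by (intro sum_mono2) auto
  also have "\<dots> \<le> (\<Sum>i\<in>I. \<Sum>S | T i \<subseteq> S \<and> S \<subseteq> E. a ^ card S)"
    using fin finI \<open>0 \<le> a\<close> by (intro sum_UN_le) auto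
  also have "\<dots> \<le> (\<Sum>i\<in>I. a\<^sup>2 * exp (real (card E) * a))"
  proof (rule sum_mono)
    fix i assume "i \<in> I"
    then have T: "T i \<subseteq> E" "card (T i) = 2"
      by (auto simp: I_def T_def card_2_iff)
    have "(\<Sum>S | T i \<subseteq> S \<and> S \<subseteq> E. a ^ card S) = a\<^sup>2 * (1 + a) ^ card (E - T i)"
      using sum_power_card_supersets[OF fin T(1), of a] T(2) by simp
    also have "(1 + a) ^ card (E - T i) \<le> (1 + a) ^ card E"
      using fin \<open>0 \<le> a\<close> by (intro power_increasing card_mono) auto
    also have "\<dots> \<le> exp (real (card E) * a)"
      using \<open>0 \<le> a\<close> by (rule one_plus_power_le_exp)
    finally show "(\<Sum>S | T i \<subseteq> S \<and> S \<subseteq> E. a ^ card S) \<le> a\<^sup>2 * exp (real (card E) * a)"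
      by (simp add: mult_left_mono)
  qed
  also have "\<dots> = real (card I) * (a\<^sup>2 * exp (real (card E) * a))"
    by simp
  also have "\<dots> \<le> real (card V ^ 3) * (a\<^sup>2 * exp (real (card E) * a))"
    using cardI by (intro mult_right_mono) (auto simp del: of_nat_power)
  finally show ?thesis by (simp add: mult.assoc)
qed

lemma card_edges_on: "finite V \<Longrightarrow> card (edges_on V) = card V choose 2"
  unfolding edges_on_def by (rule n_subsets)

lemma real_choose_two: "real (n choose 2) = real n * (real n - 1) / 2"
  by (induction n) (simp_all add: numeral_2_eq_2 field_simps)

text \<open>For a matching of size \<open>k\<close> the coefficient error is \<open>l ^ k\<close>
  times at most \<open>8 * k^2 * l\<close>, whose square gives \<open>64 * l^2\<close>. Otherwise
  the inclusion probability is 0 and the error is just \<open>\<mu> ^ card S\<close>, with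
  \<open>\<mu> \<le> l\<close>. The exponentials stay bounded because
  \<open>card E * l^2 \<le> 1\<close>.\<close>

lemma sum_inclusion_prob_diff_square_le:
  fixes r l :: real
  assumes V: "finite V" "card V = n" "0 < n" and l: "0 < l" "real n * l \<le> 1 / 2" and "0 \<le> r"
  defines "E \<equiv> edges_on V" and "\<mu> \<equiv> l * (clique_Z l (n - 2) / clique_Z l n)"
  shows "(\<Sum>S\<in>Pow E. (inclusion_prob E l S - \<mu> ^ card S)\<^sup>2 * r ^ card S) \<le>
    (64 + r\<^sup>2) * exp (16 * r) / real n"
proof -
  define \<theta> where "\<theta> = clique_Z l (n - 2) / clique_Z l n"
  have \<mu>: "\<mu> = l * \<theta>" by (simp add: \<mu>_def \<theta>_def)
  have fin: "finite E" using V by (simp add: E_def)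
  have \<theta>: "0 \<le> \<theta>" "\<theta> \<le> 1"
    unfolding \<theta>_def using clique_Z_quotient_bounds[of l n] l by simp_all
  have nl: "l \<le> 1 / real n" using l V by (simp add: field_simps)
  have "real (card E) \<le> (real n)\<^sup>2"
    using V by (simp add: E_def card_edges_on real_choose_two power2_eq_square field_simps)
  then have "real (card E) * l\<^sup>2 \<le> (real n)\<^sup>2 * (1 / real n)\<^sup>2"
    using nl l by (intro mult_mono power_mono) auto
  then have El: "real (card E) * l\<^sup>2 \<le> 1"
    using V by (simp add: power2_eq_square)
  have matching: "(inclusion_prob E l S - \<mu> ^ card S)\<^sup>2 * r ^ card S \<le> 64 * l\<^sup>2 * (16 * l\<^sup>2 * r) ^ card S"
    if S: "S \<in> matchings E" for S
  proof -
    define k where "k = card S"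
    define R where "R = clique_Z l (n - 2 * k) / clique_Z l n"
    have k: "2 * k \<le> n" and incl: "inclusion_prob E l S = l ^ k * R"
      using inclusion_prob_matching(1)[of V S] inclusion_prob_matching(2)[of V S l] S V by (simp_all add: E_def k_def R_def)
    have "\<bar>R - \<theta> ^ k\<bar> \<le> 8 * (real k)\<^sup>2 * l"
      unfolding R_def \<theta>_def using l k by (intro clique_Z_quotient_approx_power) auto
    then have "(R - \<theta> ^ k)\<^sup>2 \<le> (8 * (real k)\<^sup>2 * l)\<^sup>2"
      by (metis abs_ge_zero power2_abs power_mono)
    also have "\<dots> = 64 * l\<^sup>2 * real k ^ 4"
      by (simp add: power_mult_distrib power2_eq_square power4_eq_xxxx)
    \<comment> \<open>The bound \<open>k < 2 ^ k\<close> trades the polynomial factor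
      \<open>k^4\<close> for \<open>16 ^ k\<close>, which the base of the geometric weight absorbs.
      This is the 16 in the exponential.\<close>
    also have "\<dots> \<le> 64 * l\<^sup>2 * (2 ^ k) ^ 4"
      by (intro mult_left_mono power_mono less_imp_le[OF of_nat_less_two_power]) auto
    also have "(2 ^ k) ^ 4 = (16 :: real) ^ k"
      by (simp add: power_mult[symmetric] mult.commute[of k] power_mult)
    finally have R: "(R - \<theta> ^ k)\<^sup>2 \<le> 64 * l\<^sup>2 * 16 ^ k" .
    have "(inclusion_prob E l S - \<mu> ^ k)\<^sup>2 * r ^ k = (R - \<theta> ^ k)\<^sup>2 * (l\<^sup>2 * r) ^ k"
      by (simp add: incl \<mu> power_mult_distrib power2_eq_square algebra_simps)
    also have "\<dots> \<le> (64 * l\<^sup>2 * 16 ^ k) * (l\<^sup>2 * r) ^ k"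
      using R \<open>0 \<le> r\<close> by (intro mult_right_mono) auto
    finally show ?thesis
      by (simp add: k_def power_mult_distrib algebra_simps)
  qed
  have not_matching: "(inclusion_prob E l S - \<mu> ^ card S)\<^sup>2 * r ^ card S \<le> (l\<^sup>2 * r) ^ card S"
    if "S \<notin> matchings E" for S
  proof -
    have "(inclusion_prob E l S - \<mu> ^ card S)\<^sup>2 * r ^ card S = (\<theta> ^ card S)\<^sup>2 * (l\<^sup>2 * r) ^ card S"
      using that by (simp add: inclusion_prob_not_matching \<mu> power_mult_distrib power2_eq_square algebra_simps)
    also have "\<dots> \<le> 1 * (l\<^sup>2 * r) ^ card S"
      using \<theta> \<open>0 \<le> r\<close> by (intro mult_right_mono power_le_one) auto
    finally show ?thesis by simp
  qed
  have "(\<Sum>S\<in>Pow E. (inclusion_prob E l S - \<mu> ^ card S)\<^sup>2 * r ^ card S) =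
      (\<Sum>S\<in>matchings E. (inclusion_prob E l S - \<mu> ^ card S)\<^sup>2 * r ^ card S) +
      (\<Sum>S\<in>Pow E - matchings E. (inclusion_prob E l S - \<mu> ^ card S)\<^sup>2 * r ^ card S)"
    using fin by (subst add.commute, intro sum.subset_diff) (auto simp: matchings_def)
  also have "(\<Sum>S\<in>matchings E. (inclusion_prob E l S - \<mu> ^ card S)\<^sup>2 * r ^ card S) \<le>
      (\<Sum>S\<in>matchings E. 64 * l\<^sup>2 * (16 * l\<^sup>2 * r) ^ card S)"
    using matching by (rule sum_mono)
  \<comment> \<open>All terms are nonnegative, so the sum may be enlarged to all edge sets, where it
    has a closed form.\<close>
  also have "\<dots> \<le> (\<Sum>S\<in>Pow E. 64 * l\<^sup>2 * (16 * l\<^sup>2 * r) ^ card S)"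
    using fin \<open>0 \<le> r\<close> by (intro sum_mono2) (auto simp: matchings_def)
  also have "\<dots> = 64 * l\<^sup>2 * (1 + 16 * l\<^sup>2 * r) ^ card E"
    by (simp only: sum_distrib_left[symmetric] sum_power_card_Pow[OF fin])
  also have "(1 + 16 * l\<^sup>2 * r) ^ card E \<le> exp (real (card E) * (16 * l\<^sup>2 * r))"
    using \<open>0 \<le> r\<close> by (intro one_plus_power_le_exp) auto
  also have "(\<Sum>S\<in>Pow E - matchings E. (inclusion_prob E l S - \<mu> ^ card S)\<^sup>2 * r ^ card S) \<le>
      (\<Sum>S\<in>Pow E - matchings E. (l\<^sup>2 * r) ^ card S)"
    using not_matching by (intro sum_mono) auto
  also have "\<dots> \<le> real n ^ 3 * (l\<^sup>2 * r)\<^sup>2 * exp (real (card E) * (l\<^sup>2 * r))"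
    using sum_power_card_not_matching_le[of V "l\<^sup>2 * r"] V \<open>0 \<le> r\<close> by (simp add: E_def)
  finally have "(\<Sum>S\<in>Pow E. (inclusion_prob E l S - \<mu> ^ card S)\<^sup>2 * r ^ card S) \<le>
      64 * l\<^sup>2 * exp (real (card E) * (16 * l\<^sup>2 * r)) +
      real n ^ 3 * (l\<^sup>2 * r)\<^sup>2 * exp (real (card E) * (l\<^sup>2 * r))"
    using l by (simp add: mult_left_mono)
  also have "\<dots> \<le> 64 * (1 / real n) * exp (16 * r) + (1 / real n * r\<^sup>2) * exp (16 * r)"
  proof -
    have "l\<^sup>2 \<le> (1 / real n)\<^sup>2" using nl l by (intro power_mono) auto
    also have "\<dots> \<le> 1 / real n" using V by (simp add: power2_eq_square field_simps)
    finally have l2: "64 * l\<^sup>2 \<le> 64 * (1 / real n)" by simp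
    have "real n ^ 3 * l ^ 4 \<le> real n ^ 3 * (1 / real n) ^ 4"
      using nl l by (intro mult_left_mono power_mono) auto
    also have "\<dots> = 1 / real n" using V by (simp add: eval_nat_numeral)
    finally have "real n ^ 3 * l ^ 4 * r\<^sup>2 \<le> 1 / real n * r\<^sup>2"
      by (intro mult_right_mono) auto
    then have l4: "real n ^ 3 * (l\<^sup>2 * r)\<^sup>2 \<le> 1 / real n * r\<^sup>2"
      by (simp add: power_mult_distrib power_mult[symmetric] mult.assoc)
    have El_r: "real (card E) * l\<^sup>2 * r \<le> 1 * r"
      using El \<open>0 \<le> r\<close> by (intro mult_right_mono)
    have e1: "exp (real (card E) * (16 * l\<^sup>2 * r)) \<le> exp (16 * r)"
      and e2: "exp (real (card E) * (l\<^sup>2 * r)) \<le> exp (16 * r)"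
      using El_r \<open>0 \<le> r\<close> by (simp_all add: algebra_simps)
    show ?thesis
      by (intro add_mono mult_mono[OF l2 e1] mult_mono[OF l4 e2]) (use \<open>0 \<le> r\<close> in auto)
  qed
  finally show ?thesis
    by (simp add: algebra_simps add_divide_distrib)
qed

subsection \<open>Logarithm of the product approximation\<close>

text \<open>The remainder vanishes at 0 and has derivative \<open>z^2 / (1 + z)\<close>, which is at
  most \<open>2 * x^2\<close> for \<open>\<bar>z\<bar> \<le> \<bar>x\<bar> \<le> 1 / 2\<close>; the
  mean value bound does the rest.\<close>

lemma abs_ln_one_plus_second_order:
  fixes x :: real
  assumes "\<bar>x\<bar> \<le> 1 / 2"
  shows "\<bar>ln (1 + x) - x + x\<^sup>2 / 2\<bar> \<le> 2 * \<bar>x\<bar> ^ 3"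
proof -
  define f where "f z = ln (1 + z) - z + z\<^sup>2 / 2" for z :: real
  have "norm (f x - f 0) \<le> 2 * x\<^sup>2 * norm (x - 0)"
  proof (rule field_differentiable_bound[where S = "{- \<bar>x\<bar>..\<bar>x\<bar>}"])
    fix z assume "z \<in> {- \<bar>x\<bar>..\<bar>x\<bar>}"
    then have z: "\<bar>z\<bar> \<le> \<bar>x\<bar>" by auto
    then have pos: "1 / 2 \<le> 1 + z" using assms by auto
    then have "(f has_field_derivative 1 / (1 + z) - 1 + z) (at z within {- \<bar>x\<bar>..\<bar>x\<bar>})"
      unfolding f_def by (auto intro!: derivative_eq_intros)
    moreover have "1 / (1 + z) - 1 + z = z\<^sup>2 / (1 + z)"
      using pos by (simp add: field_simps power2_eq_square)
    ultimately show "(f has_field_derivative z\<^sup>2 / (1 + z)) (at z within {- \<bar>x\<bar>..\<bar>x\<bar>})"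
      by simp
    have "z\<^sup>2 / (1 + z) \<le> x\<^sup>2 / (1 / 2)"
      using pos z by (intro frac_le) (auto simp: abs_le_square_iff)
    then show "norm (z\<^sup>2 / (1 + z)) \<le> 2 * x\<^sup>2"
      using pos by simp
  qed auto
  then show ?thesis
    by (simp add: f_def power3_eq_cube power2_eq_square abs_mult mult.assoc)
qed

text \<open>Follows from \<open>ln t \<le> t - 1\<close> at \<open>t = u / v\<close>. It carries an
  estimate of the likelihood ratio over to its logarithm, provided that both arguments stay above
  \<open>\<delta>\<close>.\<close>

lemma abs_ln_diff_le:
  fixes x y \<delta> :: real
  assumes "0 < \<delta>" "\<delta> \<le> x" "\<delta> \<le> y"
  shows "\<bar>ln x - ln y\<bar> \<le> \<bar>x - y\<bar> / \<delta>"
proof -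
  have *: "ln u - ln v \<le> \<bar>u - v\<bar> / \<delta>" if "\<delta> \<le> u" "\<delta> \<le> v" for u v
  proof -
    have "ln u - ln v = ln (u / v)" using that assms by (simp add: ln_div)
    also have "\<dots> \<le> u / v - 1" using that assms by (intro ln_le_minus_one) auto
    also have "\<dots> = (u - v) / v" using that assms by (simp add: diff_divide_distrib)
    also have "\<dots> \<le> \<bar>u - v\<bar> / \<delta>" using that assms by (intro frac_le) auto
    finally show ?thesis .
  qed
  show ?thesis
    using *[of x y] *[of y x] assms by (simp add: abs_minus_commute abs_le_iff)
qed

text \<open>Each factor takes only two values, so its logarithm is affine in
  \<open>of_bool (A e)\<close>. Centring at \<open>p\<close> leaves the signed edge count and a
  deterministic term.\<close>

lemma ln_prod_centered_bernoulli:
  assumes "finite E" and p: "0 < p" "p < 1" and \<mu>: "0 \<le> \<mu>" "\<mu> < 1"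
  defines "a \<equiv> ln (1 + \<mu> * ((1 - p) / p))" and "b \<equiv> ln (1 - \<mu>)"
  shows "0 < (\<Prod>e\<in>E. 1 + \<mu> * (of_bool (A e) / p - 1))"
    and "ln (\<Prod>e\<in>E. 1 + \<mu> * (of_bool (A e) / p - 1)) =
      (\<Sum>e\<in>E. of_bool (A e) - p) * (a - b) + real (card E) * (p * a + (1 - p) * b)"
proof -
  have "0 \<le> \<mu> * (1 / p - 1)"
    using p \<mu> by (intro mult_nonneg_nonneg) (auto simp: field_simps)
  then have pos: "0 < 1 + \<mu> * (of_bool (A e) / p - 1)" for e
    using \<mu> by (cases "A e") auto
  then show "0 < (\<Prod>e\<in>E. 1 + \<mu> * (of_bool (A e) / p - 1))"
    by (intro prod_pos) auto
  have "ln (\<Prod>e\<in>E. 1 + \<mu> * (of_bool (A e) / p - 1)) =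
      (\<Sum>e\<in>E. ln (1 + \<mu> * (of_bool (A e) / p - 1)))"
    using pos \<open>finite E\<close> by (intro ln_prod) (auto simp: less_le)
  also have "\<dots> = (\<Sum>e\<in>E. (of_bool (A e) - p) * (a - b) + (p * a + (1 - p) * b))"
  proof (rule sum.cong)
    fix e
    have "1 / p - 1 = (1 - p) / p" using p by (simp add: field_simps)
    then show "ln (1 + \<mu> * (of_bool (A e) / p - 1)) =
        (of_bool (A e) - p) * (a - b) + (p * a + (1 - p) * b)"
      by (cases "A e") (simp_all add: a_def b_def algebra_simps)
  qed simp
  also have "\<dots> = (\<Sum>e\<in>E. of_bool (A e) - p) * (a - b) + real (card E) * (p * a + (1 - p) * b)"
    by (simp add: sum.distrib sum_distrib_right)
  finally show "ln (\<Prod>e\<in>E. 1 + \<mu> * (of_bool (A e) / p - 1)) =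
      (\<Sum>e\<in>E. of_bool (A e) - p) * (a - b) + real (card E) * (p * a + (1 - p) * b)" .
qed

text \<open>Deterministic Taylor expansion, with \<open>K\<close> for the signed edge count, whose
  standard deviation is of order \<open>n\<close>, and \<open>N * \<mu>\<close> for the expected
  matching size. The first bound keeps the product away from 0; the second identifies the main
  term.\<close>

lemma log_product_approx:
  fixes p \<mu> K C :: real and n :: nat
  assumes p: "0 < p" "p < 1" and n: "2 \<le> n" and \<mu>: "0 \<le> \<mu>" "\<mu> \<le> 1 / real n"
    and r\<mu>: "\<mu> * ((1 - p) / p) \<le> 1 / 2" and K: "\<bar>K\<bar> \<le> C * real n"
  defines "r \<equiv> (1 - p) / p" and "N \<equiv> real (n choose 2)"
  defines "L \<equiv> K * (ln (1 + \<mu> * r) - ln (1 - \<mu>)) + N * (p * ln (1 + \<mu> * r) + (1 - p) * ln (1 - \<mu>))"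
  shows "\<bar>L\<bar> \<le> C * (1 / p + 2 * r\<^sup>2 + 2) + (r + 2 * r ^ 3 + 2)"
    and "\<bar>L - (- r * (N * \<mu> / real n)\<^sup>2 +
        sqrt (2 * (1 - p) / p) * (N * \<mu> / real n) * (K / sqrt (N * p * (1 - p))))\<bar>
      \<le> (C * (1 / p + 2 * r\<^sup>2 + 2) + (r + 2 * r ^ 3 + 2)) / real n"
proof -
  have r: "0 < r" and pr: "p * r = 1 - p" and r1: "r + 1 = 1 / p"
    using p by (simp_all add: r_def field_simps)
  have prr: "p * r\<^sup>2 + (1 - p) = r"
    using p by (simp add: r_def power2_eq_square field_simps)
  have N_eq: "N = real n * (real n - 1) / 2"
    by (simp add: N_def real_choose_two)
  have N: "0 < N" "N \<le> (real n)\<^sup>2"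
    using n by (simp_all add: N_eq power2_eq_square field_simps)
  have C: "0 \<le> C"
  proof -
    have "0 \<le> C * real n" using K abs_ge_zero order_trans by blast
    then show ?thesis using n by (simp add: zero_le_mult_iff)
  qed
  have \<mu>half: "\<mu> \<le> 1 / 2"
    by (rule order_trans[OF \<mu>(2)]) (use n in \<open>simp add: field_simps\<close>)
  have \<mu>n: "\<mu> * real n \<le> 1"
    using \<mu>(2) n by (simp add: field_simps)
  define a where "a = ln (1 + \<mu> * r) - ln (1 - \<mu>)"
  define b where "b = p * ln (1 + \<mu> * r) + (1 - p) * ln (1 - \<mu>)"
  have \<mu>r: "0 \<le> \<mu> * r" "\<mu> * r \<le> 1 / 2"
    using \<mu> r r\<mu> unfolding r_def[symmetric] by simp_all
  have "\<bar>ln (1 + \<mu> * r) - \<mu> * r\<bar> \<le> 2 * (\<mu> * r)\<^sup>2"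
    using \<mu>r by (intro abs_ln_one_plus_x_minus_x_bound) auto
  moreover have "\<bar>ln (1 + - \<mu>) - - \<mu>\<bar> \<le> 2 * (- \<mu>)\<^sup>2"
    using \<mu> \<mu>half by (intro abs_ln_one_plus_x_minus_x_bound) auto
  moreover have "\<mu> / p = \<mu> * r + \<mu>"
    using arg_cong[OF r1, of "\<lambda>x. \<mu> * x"] by (simp add: distrib_left)
  ultimately have "\<bar>a - \<mu> / p\<bar> \<le> 2 * (\<mu> * r)\<^sup>2 + 2 * \<mu>\<^sup>2"
    unfolding a_def by simp
  then have a: "\<bar>a - \<mu> / p\<bar> \<le> (2 * r\<^sup>2 + 2) * \<mu>\<^sup>2"
    by (simp add: power_mult_distrib algebra_simps)
  have "\<bar>ln (1 + \<mu> * r) - \<mu> * r + (\<mu> * r)\<^sup>2 / 2\<bar> \<le> 2 * (\<mu> * r) ^ 3"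
    using abs_ln_one_plus_second_order[of "\<mu> * r"] \<mu>r by (simp only: abs_of_nonneg)
  then have b1: "\<bar>p * (ln (1 + \<mu> * r) - \<mu> * r + (\<mu> * r)\<^sup>2 / 2)\<bar> \<le> 1 * (2 * (\<mu> * r) ^ 3)"
    unfolding abs_mult[of p] using p by (intro mult_mono) simp_all
  have "\<bar>ln (1 - \<mu>) + \<mu> + \<mu>\<^sup>2 / 2\<bar> \<le> 2 * \<mu> ^ 3"
    using abs_ln_one_plus_second_order[of "- \<mu>"] \<mu> \<mu>half by simp
  then have b2: "\<bar>(1 - p) * (ln (1 - \<mu>) + \<mu> + \<mu>\<^sup>2 / 2)\<bar> \<le> 1 * (2 * \<mu> ^ 3)"
    unfolding abs_mult[of "1 - p"] using p by (intro mult_mono) simp_all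
  \<comment> \<open>The first-order terms cancel because \<open>p * r = 1 - p\<close>; the
    second-order ones combine to \<open>r\<close> because
    \<open>p * r^2 + (1 - p) = r\<close>.\<close>
  have "b + \<mu>\<^sup>2 * r / 2 = p * (ln (1 + \<mu> * r) - \<mu> * r + (\<mu> * r)\<^sup>2 / 2) +
      (1 - p) * (ln (1 - \<mu>) + \<mu> + \<mu>\<^sup>2 / 2) + \<mu> * (p * r - (1 - p)) -
      \<mu>\<^sup>2 / 2 * (p * r\<^sup>2 + (1 - p) - r)"
    by (simp add: b_def field_simps power2_eq_square)
  then have "\<bar>b + \<mu>\<^sup>2 * r / 2\<bar> \<le> 1 * (2 * (\<mu> * r) ^ 3) + 1 * (2 * \<mu> ^ 3)"
    using b1 b2 unfolding pr prr by simp
  then have b: "\<bar>b + \<mu>\<^sup>2 * r / 2\<bar> \<le> (2 * r ^ 3 + 2) * \<mu> ^ 3"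
    by (simp add: power_mult_distrib algebra_simps)
  have L: "L = K * a + N * b"
    by (simp add: L_def a_def b_def)
  have sq: "(\<mu> * real n)\<^sup>2 \<le> 1"
    using \<mu>n \<mu> by (intro power_le_one) auto
  have Ka: "\<bar>K * (a - \<mu> / p)\<bar> \<le> C * (2 * r\<^sup>2 + 2) / real n"
  proof -
    have "\<bar>K * (a - \<mu> / p)\<bar> \<le> (C * real n) * ((2 * r\<^sup>2 + 2) * \<mu>\<^sup>2)"
      unfolding abs_mult using K a C by (intro mult_mono) auto
    also have "\<dots> = C * (2 * r\<^sup>2 + 2) / real n * (\<mu> * real n)\<^sup>2"
      using n by (simp add: power2_eq_square field_simps)
    also have "\<dots> \<le> C * (2 * r\<^sup>2 + 2) / real n * 1"
      using sq C by (intro mult_left_mono) auto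
    finally show ?thesis by simp
  qed
  have Nb: "\<bar>N * (b + \<mu>\<^sup>2 * r / 2)\<bar> \<le> (2 * r ^ 3 + 2) / real n"
  proof -
    have "\<bar>N * (b + \<mu>\<^sup>2 * r / 2)\<bar> \<le> (real n)\<^sup>2 * ((2 * r ^ 3 + 2) * \<mu> ^ 3)"
      unfolding abs_mult using N b by (intro mult_mono) auto
    also have "\<dots> = (2 * r ^ 3 + 2) / real n * (\<mu> * real n) ^ 3"
      using n by (simp add: power2_eq_square power3_eq_cube field_simps)
    also have "\<dots> \<le> (2 * r ^ 3 + 2) / real n * 1"
      using \<mu>n \<mu> r by (intro mult_left_mono power_le_one) auto
    finally show ?thesis by simp
  qed
  have K\<mu>: "\<bar>K * (\<mu> / p)\<bar> \<le> C / p"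
  proof -
    have "\<bar>K * (\<mu> / p)\<bar> = \<bar>K\<bar> * (\<mu> / p)"
      using \<mu> p by (simp add: abs_mult)
    also have "\<dots> \<le> (C * real n) * (\<mu> / p)"
      using K \<mu> p by (intro mult_right_mono) auto
    also have "\<dots> = C / p * (\<mu> * real n)" by simp
    also have "\<dots> \<le> C / p * 1" using \<mu>n C p by (intro mult_left_mono) auto
    finally show ?thesis by simp
  qed
  have N\<mu>: "N * \<mu>\<^sup>2 \<le> 1"
  proof -
    have "N * \<mu>\<^sup>2 \<le> (real n)\<^sup>2 * \<mu>\<^sup>2" using N by (intro mult_right_mono) auto
    then show ?thesis using sq by (simp add: power_mult_distrib mult.commute)
  qed
  have half: "0 \<le> N * \<mu>\<^sup>2 * (r / 2)" "N * \<mu>\<^sup>2 * (r / 2) \<le> 1 * r"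
    using N N\<mu> r by (auto intro!: mult_mono)
  have n1: "1 \<le> real n" using n by simp
  show "\<bar>L\<bar> \<le> C * (1 / p + 2 * r\<^sup>2 + 2) + (r + 2 * r ^ 3 + 2)"
  proof -
    have "L = K * (\<mu> / p) + K * (a - \<mu> / p) + N * (b + \<mu>\<^sup>2 * r / 2) - N * \<mu>\<^sup>2 * (r / 2)"
      by (simp add: L algebra_simps)
    moreover have "C * (2 * r\<^sup>2 + 2) / real n \<le> C * (2 * r\<^sup>2 + 2) / 1"
      using n1 C by (intro divide_left_mono) auto
    moreover have "(2 * r ^ 3 + 2) / real n \<le> (2 * r ^ 3 + 2) / 1"
      using n1 r by (intro divide_left_mono) auto
    ultimately have "\<bar>L\<bar> \<le> C / p + C * (2 * r\<^sup>2 + 2) / 1 + (2 * r ^ 3 + 2) / 1 + 1 * r"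
      using K\<mu> Ka Nb half by linarith
    then show ?thesis by (simp add: algebra_simps)
  qed
  \<comment> \<open>This is \<open>sqrt (2 * N) / n\<close>: normalising by the exact variance
    multiplies the linear term \<open>K * \<mu> / p\<close> by \<open>\<sigma>\<close>, which is
    within \<open>1 / n\<close> of 1.\<close>
  define \<sigma> where "\<sigma> = sqrt ((real n - 1) / real n)"
  have \<sigma>2: "\<sigma>\<^sup>2 = 1 - 1 / real n"
    using n1 by (simp add: \<sigma>_def diff_divide_distrib)
  have \<sigma>: "0 \<le> \<sigma>" "\<sigma> \<le> 1"
    using n1 by (simp_all add: \<sigma>_def)
  then have "\<sigma>\<^sup>2 \<le> \<sigma>" by (simp add: power2_eq_square mult_left_le)
  then have \<sigma>1: "\<bar>\<sigma> - 1\<bar> \<le> 1 / real n" using \<sigma> \<sigma>2 by simp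
  have "(sqrt (2 * (1 - p) / p) * (N / real n) / sqrt (N * p * (1 - p)))\<^sup>2 = (\<sigma> / p)\<^sup>2"
  proof -
    have "(sqrt (2 * (1 - p) / p) * (N / real n) / sqrt (N * p * (1 - p)))\<^sup>2 =
        2 * (1 - p) / p * (N / real n)\<^sup>2 / (N * p * (1 - p))"
      using p N by (simp add: power_mult_distrib power_divide)
    also have "\<dots> = 2 * N / (real n * p)\<^sup>2"
    proof -
      have "2 * q / p * (N / x)\<^sup>2 / (N * p * q) = 2 * N / (x * p)\<^sup>2" 
        if "q \<noteq> 0" "x \<noteq> 0" for q x
        using p N that by (simp add: field_simps power2_eq_square)
      from this[of "1 - p" "real n"] show ?thesis using p n1 by simp
    qed
    also have "\<dots> = (1 - 1 / real n) / p\<^sup>2"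
      using p n1 unfolding N_eq by (simp add: divide_simps power2_eq_square)
    also have "\<dots> = (\<sigma> / p)\<^sup>2"
      by (simp add: power_divide \<sigma>2)
    finally show ?thesis .
  qed
  then have "sqrt (2 * (1 - p) / p) * (N / real n) / sqrt (N * p * (1 - p)) = \<sigma> / p"
    by (rule power2_eq_imp_eq) (use p N \<sigma> in simp_all)
  moreover have "sqrt (2 * (1 - p) / p) * (N * \<mu> / real n) * (K / sqrt (N * p * (1 - p))) =
      sqrt (2 * (1 - p) / p) * (N / real n) / sqrt (N * p * (1 - p)) * (K * \<mu>)"
    by simp
  ultimately have lin: "sqrt (2 * (1 - p) / p) * (N * \<mu> / real n) * (K / sqrt (N * p * (1 - p))) =
      K * (\<mu> / p) * \<sigma>"
    by simp
  \<comment> \<open>In the quadratic term \<open>N\<close> is not exactly \<open>n^2 / 2\<close>;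
    the discrepancy is a fraction \<open>1 / n\<close> of a bounded quantity.\<close>
  have N_quot: "N / (real n)\<^sup>2 = 1 / 2 - 1 / (2 * real n)"
    using n1 by (simp add: N_eq power2_eq_square diff_divide_distrib)
  have "r * (N * \<mu> / real n)\<^sup>2 = r * (N * \<mu>\<^sup>2) * (N / (real n)\<^sup>2)"
    by (simp add: power_divide power_mult_distrib power2_eq_square)
  then have quad: "r * (N * \<mu> / real n)\<^sup>2 = N * \<mu>\<^sup>2 * (r / 2) - N * \<mu>\<^sup>2 * (r / 2) / real n"
    unfolding N_quot by (simp add: right_diff_distrib mult_ac)
  have "L - (- r * (N * \<mu> / real n)\<^sup>2 +
        sqrt (2 * (1 - p) / p) * (N * \<mu> / real n) * (K / sqrt (N * p * (1 - p)))) =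
      K * (a - \<mu> / p) + N * (b + \<mu>\<^sup>2 * r / 2) - K * (\<mu> / p) * (\<sigma> - 1) - N * \<mu>\<^sup>2 * (r / 2) / real n"
    unfolding lin mult_minus_left quad L by (simp add: algebra_simps diff_divide_distrib)
  moreover have "\<bar>K * (\<mu> / p) * (\<sigma> - 1)\<bar> \<le> C / p * (1 / real n)"
    using K\<mu> \<sigma>1 C p unfolding abs_mult[of "K * (\<mu> / p)"] by (intro mult_mono) auto
  moreover have "0 \<le> N * \<mu>\<^sup>2 * (r / 2) / real n"
    by (intro divide_nonneg_nonneg half) simp
  moreover have "N * \<mu>\<^sup>2 * (r / 2) / real n \<le> 1 * r / real n"
    by (intro divide_right_mono half) simp
  ultimately have "\<bar>L - (- r * (N * \<mu> / real n)\<^sup>2 +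
        sqrt (2 * (1 - p) / p) * (N * \<mu> / real n) * (K / sqrt (N * p * (1 - p))))\<bar> \<le>
      C * (2 * r\<^sup>2 + 2) / real n + (2 * r ^ 3 + 2) / real n + C / p * (1 / real n) + 1 * r / real n"
    using Ka Nb by linarith
  then show "\<bar>L - (- r * (N * \<mu> / real n)\<^sup>2 +
        sqrt (2 * (1 - p) / p) * (N * \<mu> / real n) * (K / sqrt (N * p * (1 - p))))\<bar>
      \<le> (C * (1 / p + 2 * r\<^sup>2 + 2) + (r + 2 * r ^ 3 + 2)) / real n"
    by (simp add: algebra_simps add_divide_distrib)
qed

subsection \<open>Moments of the signed edge count\<close>

lemma signed_edge_count_eq:
  assumes "0 < p"
  shows "signed_edge_count n p A = (\<Sum>e\<in>complete_edges n. p * character p {e} A)"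
  using assms by (simp add: signed_edge_count_def character_def algebra_simps)

lemma integrable_erdos_renyi [simp]:
  fixes f :: "adjacency \<Rightarrow> real"
  shows "integrable (measure_pmf (erdos_renyi n p)) f"
  unfolding erdos_renyi_def
  by (intro integrable_measure_pmf_finite finite_set_pmf_Pi_bernoulli)
    (simp add: complete_edges_eq)

lemma expectation_signed_edge_count:
  assumes p: "0 < p" "p < 1"
  shows "measure_pmf.expectation (erdos_renyi n p) (signed_edge_count n p) = 0"
proof -
  have fin: "finite (complete_edges n)" by (simp add: complete_edges_eq)
  \<comment> \<open>The mean is the inner product with the character of the empty set, which is
    constantly 1.\<close>
  have "measure_pmf.expectation (erdos_renyi n p) (\<lambda>A. character p {e} A) = 0"
    if "e \<in> complete_edges n" for e
    using expectation_character_mult[OF fin, of "{e}" "{}" p] that p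
    by (simp add: erdos_renyi_def character_def)
  then show ?thesis
    unfolding signed_edge_count_eq[OF p(1)] by (simp add: Bochner_Integration.integral_sum)
qed

lemma expectation_signed_edge_count_square:
  assumes p: "0 < p" "p < 1"
  shows "measure_pmf.expectation (erdos_renyi n p) (\<lambda>A. (signed_edge_count n p A)\<^sup>2) =
    real (n choose 2) * p * (1 - p)"
proof -
  let ?E = "complete_edges n"
  have fin: "finite ?E" by (simp add: complete_edges_eq)
  have "(signed_edge_count n p A)\<^sup>2 =
      (\<Sum>e\<in>?E. \<Sum>f\<in>?E. p\<^sup>2 * (character p {e} A * character p {f} A))" for A
    unfolding signed_edge_count_eq[OF p(1)] power2_eq_square sum_product by (simp only: mult_ac)
  then have "measure_pmf.expectation (erdos_renyi n p) (\<lambda>A. (signed_edge_count n p A)\<^sup>2) =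
      (\<Sum>e\<in>?E. \<Sum>f\<in>?E. p\<^sup>2 * measure_pmf.expectation (erdos_renyi n p)
        (\<lambda>A. character p {e} A * character p {f} A))"
    by (simp add: Bochner_Integration.integral_sum)
  also have "\<dots> = (\<Sum>e\<in>?E. \<Sum>f\<in>?E. if f = e then p\<^sup>2 * ((1 - p) / p) else 0)"
    using p by (intro sum.cong refl)
      (auto simp: erdos_renyi_def expectation_character_mult[OF fin])
  also have "\<dots> = real (card ?E) * (p * (1 - p))"
    using fin p by (simp add: power2_eq_square)
  finally show ?thesis
    by (simp add: complete_edges_eq card_edges_on)
qed

subsection \<open>Expansion of the log-likelihood ratio\<close>

text \<open>By symmetry all edges have the same inclusion probability. This turns
  \<open>N * \<mu>\<close> in the expansion into the expected matching size.\<close>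

lemma expected_matching_size_eq:
  assumes "2 \<le> n" "0 < l"
  shows "expected_matching_size n l =
    real (n choose 2) * (l * (clique_Z l (n - 2) / clique_Z l n))"
proof -
  let ?E = "edges_on {1..n}"
  have "inclusion_prob ?E l {e} = l * (clique_Z l (n - 2) / clique_Z l n)" if "e \<in> ?E" for e
  proof -
    have "{e} \<in> matchings ?E" using that by (simp add: matchings_def)
    then show ?thesis using inclusion_prob_matching(2)[of "{1..n}" "{e}" l] by simp
  qed
  then show ?thesis
    using assms unfolding expected_matching_size_def complete_edges_eq
    by (simp add: expectation_card_monomer_dimer card_edges_on)
qed

text \<open>Multiplying out the product gives \<open>character p S\<close> the coefficient
  \<open>\<mu> ^ card S\<close>, so Parseval reduces the claim to the coefficient errors. The
  expansion of the likelihood ratio is available on the support only, hence the comparison almost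
  everywhere.\<close>

lemma expectation_likelihood_ratio_minus_product:
  assumes p: "0 < p" "p < 1" and n: "0 < n" and l: "0 < l" "real n * l \<le> 1 / 2"
  defines "r \<equiv> (1 - p) / p" and "\<mu> \<equiv> l * (clique_Z l (n - 2) / clique_Z l n)"
  shows "measure_pmf.expectation (erdos_renyi n p)
      (\<lambda>A. (pmf (planted_matching n p l) A / pmf (erdos_renyi n p) A -
        (\<Prod>e\<in>complete_edges n. 1 + \<mu> * (of_bool (A e) / p - 1)))\<^sup>2) \<le>
    (64 + r\<^sup>2) * exp (16 * r) / real n"
proof -
  let ?E = "complete_edges n"
  have fin: "finite ?E" by (simp add: complete_edges_eq)
  have "(\<Prod>e\<in>?E. 1 + \<mu> * (of_bool (A e) / p - 1)) = (\<Sum>S\<in>Pow ?E. \<mu> ^ card S * character p S A)"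
    for A
    using prod_add[OF fin, of "\<lambda>e. \<mu> * (of_bool (A e) / p - 1)" "\<lambda>_. 1"]
    by (simp add: character_def prod.distrib add.commute)
  then have "measure_pmf.expectation (erdos_renyi n p)
      (\<lambda>A. (pmf (planted_matching n p l) A / pmf (erdos_renyi n p) A -
        (\<Prod>e\<in>?E. 1 + \<mu> * (of_bool (A e) / p - 1)))\<^sup>2) =
    measure_pmf.expectation (erdos_renyi n p)
      (\<lambda>A. (\<Sum>S\<in>Pow ?E. (inclusion_prob ?E l S - \<mu> ^ card S) * character p S A)\<^sup>2)"
    using p l
    by (intro integral_cong_AE)
      (auto simp: AE_measure_pmf_iff likelihood_ratio_planted_matching left_diff_distrib sum_subtractf)
  also have "\<dots> = (\<Sum>S\<in>Pow ?E. (inclusion_prob ?E l S - \<mu> ^ card S)\<^sup>2 * r ^ card S)"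
    unfolding erdos_renyi_def r_def by (rule expectation_character_sum_square[OF fin p])
  also have "\<dots> \<le> (64 + r\<^sup>2) * exp (16 * r) / real n"
    unfolding complete_edges_eq \<mu>_def
    using p n l by (intro sum_inclusion_prob_diff_square_le) (auto simp: r_def)
  finally show ?thesis .
qed

theorem theorem2p7:
  fixes p q \<zeta> :: real and lam :: "nat \<Rightarrow> real"
  assumes "p = q" and "0 < p" and "p < 1"
    and "\<zeta> \<ge> 40"
    and "\<And>n. lam n = 1 / (\<zeta> * real n)"
  shows "bigO_in_probability (\<lambda>n. measure_pmf (erdos_renyi n q))
    (\<lambda>n A.
       log_likelihood_ratio (measure_pmf (planted_matching n p (lam n)))
         (measure_pmf (erdos_renyi n q)) A
       - (- ((1 - p) / p) * (expected_matching_size n (lam n) / real n)\<^sup>2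
          + sqrt (2 * (1 - p) / p) * (expected_matching_size n (lam n) / real n)
            * (signed_edge_count n q A
               / sqrt (measure_pmf.variance (erdos_renyi n q) (signed_edge_count n q)))))
    (\<lambda>n. 1 / (p * sqrt (real n)))"
  (is "bigO_in_probability _ ?X _")
  unfolding bigO_in_probability_def bounded_in_probability_def
proof (intro allI impI)
  fix \<epsilon> :: real assume "0 < \<epsilon>"
  note p = \<open>0 < p\<close> \<open>p < 1\<close>
  define r where "r = (1 - p) / p"
  have r: "0 < r" using p by (simp add: r_def)
  define D where "D = (64 + r\<^sup>2) * exp (16 * r)"
  have D: "0 < D" by (simp add: D_def add_pos_nonneg)
  \<comment> \<open>Chosen so that the two Chebyshev bounds \<open>1 / C^2\<close> and
    \<open>D / C^2\<close> add up to \<open>\<epsilon>\<close>.\<close>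
  define C where "C = sqrt ((1 + D) / \<epsilon>)"
  have C: "0 < C" "(1 + D) / C\<^sup>2 = \<epsilon>"
    using D \<open>0 < \<epsilon>\<close> by (simp_all add: C_def)
  define B where "B = C * (1 / p + 2 * r\<^sup>2 + 2) + (r + 2 * r ^ 3 + 2)"
  have B: "0 < B" using C r p by (simp add: B_def add_pos_pos)
  \<comment> \<open>Half of the lower bound \<open>exp (- B)\<close> for the product, so that the
    likelihood ratio stays above \<open>\<delta>\<close> when it is within \<open>\<delta>\<close>
    of the product.\<close>
  define \<delta> where "\<delta> = exp (- B) / 2"
  have \<delta>: "0 < \<delta>" by (simp add: \<delta>_def)
  \<comment> \<open>\<open>C / \<delta>\<close> pays for replacing the likelihood ratio by the
    product, \<open>B\<close> for expanding the logarithm of the product; the factor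
    \<open>p\<close> matches the \<open>1 / p\<close> in the rate.\<close>
  define C' where "C' = p * (C / \<delta> + B)"
  have "0 < C'" using p C B \<delta> by (simp add: C'_def add_pos_pos)
  moreover have "\<P>(A in measure_pmf (erdos_renyi n q). \<bar>?X n A / (1 / (p * sqrt (real n)))\<bar> > C') \<le> \<epsilon>"
    if n: "2 \<le> n" "r \<le> real n" "(C / \<delta>)\<^sup>2 \<le> real n" for n
  proof -
    define l where "l = lam n"
    define N where "N = real (n choose 2)"
    define \<mu> where "\<mu> = l * (clique_Z l (n - 2) / clique_Z l n)"
    define Q where "Q = erdos_renyi n p"
    define LR where "LR A = pmf (planted_matching n p l) A / pmf Q A" for A
    define Y where "Y A = (\<Prod>e\<in>complete_edges n. 1 + \<mu> * (of_bool (A e) / p - 1))" for A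
    define K where "K = signed_edge_count n p"
    define T where "T A = - r * (N * \<mu> / real n)\<^sup>2 +
      sqrt (2 * (1 - p) / p) * (N * \<mu> / real n) * (K A / sqrt (N * p * (1 - p)))" for A
    \<comment> \<open>Off this event all estimates are deterministic; the two parts are an atypical
      edge count and a poor product approximation.\<close>
    define bad where "bad = {A. \<bar>K A\<bar> \<ge> C * real n} \<union> {A. \<bar>LR A - Y A\<bar> \<ge> C / sqrt (real n)}"
    have n0: "0 < real n" using n by simp
    have l_eq: "l = 1 / (\<zeta> * real n)" using assms(5) by (simp add: l_def)
    \<comment> \<open>The lower bound on \<open>\<zeta>\<close> places \<open>n * l\<close> within
      the range \<open>n * l \<le> 1 / 2\<close> where the recursion of the ratios
      contracts.\<close>
    have "1 / (\<zeta> * real n) \<le> 1 / (40 * real n)"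
      using assms(4) n0 by (intro divide_left_mono mult_right_mono) auto
    then have l: "0 < l" "real n * l \<le> 1 / 40"
      using assms(4) n0 by (simp_all add: l_eq field_simps)
    have "\<mu> \<le> l" "0 \<le> \<mu>"
      unfolding \<mu>_def using clique_Z_quotient_bounds[of l n] l
      by (auto intro!: mult_left_le mult_nonneg_nonneg simp del: times_divide_eq_right)
    then have "real n * \<mu> \<le> real n * l" by (intro mult_left_mono) auto
    then have \<mu>: "0 \<le> \<mu>" "\<mu> * real n \<le> 1 / 40"
      using l \<open>0 \<le> \<mu>\<close> unfolding mult.commute[of \<mu>] by linarith+
    then have \<mu>n: "\<mu> \<le> 1 / real n" using n0 by (simp add: field_simps)
    have "\<mu> * r \<le> \<mu> * real n" using n \<mu> by (intro mult_left_mono)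
    then have \<mu>r: "\<mu> * ((1 - p) / p) \<le> 1 / 2" using \<mu> by (simp add: r_def)
    have "1 / real n \<le> 1 / 2" using n by (simp add: field_simps)
    then have \<mu>1: "\<mu> < 1" using \<mu>n by linarith
    have m: "expected_matching_size n (lam n) = N * \<mu>"
      using expected_matching_size_eq[OF n(1) l(1)] by (simp add: l_def N_def \<mu>_def)
    have var: "measure_pmf.variance Q K = N * p * (1 - p)"
      using p by (simp add: Q_def K_def expectation_signed_edge_count N_def
          expectation_signed_edge_count_square)
    have X: "?X n A = log_likelihood_ratio (measure_pmf (planted_matching n p l)) (measure_pmf Q) A -
        T A" for A
      using var unfolding m T_def by (simp add: r_def Q_def K_def l_def \<open>p = q\<close>)
    have good: "\<bar>?X n A\<bar> \<le> C' / (p * sqrt (real n))" if A: "A \<in> set_pmf Q" "A \<notin> bad" for A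
    proof -
      have K: "\<bar>K A\<bar> \<le> C * real n" and LY: "\<bar>LR A - Y A\<bar> \<le> C / sqrt (real n)"
        using A(2) by (auto simp: bad_def)
      have fin: "finite (complete_edges n)" by (simp add: complete_edges_eq)
      have Y_pos: "0 < Y A"
        unfolding Y_def by (rule ln_prod_centered_bernoulli(1)[OF fin p \<mu>(1) \<mu>1])
      have ln_Y: "ln (Y A) = K A * (ln (1 + \<mu> * ((1 - p) / p)) - ln (1 - \<mu>)) +
          N * (p * ln (1 + \<mu> * ((1 - p) / p)) + (1 - p) * ln (1 - \<mu>))"
        unfolding Y_def K_def signed_edge_count_def N_def
        by (simp add: ln_prod_centered_bernoulli(2)[OF fin p \<mu>(1) \<mu>1])
          (simp add: complete_edges_eq card_edges_on)
      have "\<bar>ln (Y A)\<bar> \<le> B"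
        unfolding ln_Y B_def r_def N_def by (rule log_product_approx(1)[OF p n(1) \<mu>(1) \<mu>n \<mu>r K])
      then have "exp (- B) \<le> exp (ln (Y A))" by (subst exp_le_cancel_iff) linarith
      then have Y: "2 * \<delta> \<le> Y A" using Y_pos by (simp add: \<delta>_def)
      have "C / \<delta> \<le> sqrt (real n)" using n(3) by (rule real_le_rsqrt)
      then have "C / sqrt (real n) \<le> \<delta>" using \<delta> n0 by (simp add: field_simps)
      then have LR: "\<delta> \<le> LR A" using Y LY by linarith
      have "\<bar>ln (LR A) - ln (Y A)\<bar> \<le> \<bar>LR A - Y A\<bar> / \<delta>"
        using \<delta> LR Y by (intro abs_ln_diff_le) auto
      also have "\<dots> \<le> C / sqrt (real n) / \<delta>"
        using LY \<delta> by (intro divide_right_mono) auto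
      finally have 1: "\<bar>ln (LR A) - ln (Y A)\<bar> \<le> C / \<delta> / sqrt (real n)"
        by (simp add: mult.commute)
      have "\<bar>ln (Y A) - T A\<bar> \<le> B / real n"
        unfolding ln_Y T_def B_def r_def N_def by (rule log_product_approx(2)[OF p n(1) \<mu>(1) \<mu>n \<mu>r K])
      also have "\<dots> \<le> B / sqrt (real n)"
        using B n0 n by (intro divide_left_mono) (auto intro: real_le_lsqrt simp: power2_eq_square)
      finally have 2: "\<bar>ln (Y A) - T A\<bar> \<le> B / sqrt (real n)" .
      have "?X n A = ln (LR A) - T A"
        unfolding X LR_def
        using log_likelihood_ratio_pmf[OF set_pmf_planted_matching_subset[OF p, of n l], of A] A(1)
        by (simp add: Q_def)
      then have "\<bar>?X n A\<bar> = \<bar>ln (LR A) - T A\<bar>" by (rule arg_cong)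
      also have "\<dots> \<le> C / \<delta> / sqrt (real n) + B / sqrt (real n)"
        using 1 2 by linarith
      also have "\<dots> = C' / (p * sqrt (real n))"
        using p by (simp add: C'_def add_divide_distrib)
      finally show ?thesis .
    qed
    have "\<P>(A in measure_pmf (erdos_renyi n q). \<bar>?X n A / (1 / (p * sqrt (real n)))\<bar> > C')
        \<le> measure_pmf.prob Q bad"
    proof -
      have "A \<in> bad" if A: "A \<in> set_pmf Q" and X: "\<bar>?X n A / (1 / (p * sqrt (real n)))\<bar> > C'" for A
      proof (rule ccontr)
        assume "A \<notin> bad"
        with A have "\<bar>?X n A\<bar> \<le> C' / (p * sqrt (real n))" by (rule good)
        moreover have "C' / (p * sqrt (real n)) < \<bar>?X n A\<bar>"
          using X p n0 by (simp add: abs_mult divide_less_eq)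
        ultimately show False by simp
      qed
      then show ?thesis
        unfolding Q_def \<open>p = q\<close>
        by (intro measure_pmf.finite_measure_mono_AE) (auto simp: AE_measure_pmf_iff)
    qed
    also have "\<dots> \<le> measure_pmf.prob Q {A. \<bar>K A\<bar> \<ge> C * real n} +
        measure_pmf.prob Q {A. \<bar>LR A - Y A\<bar> \<ge> C / sqrt (real n)}"
      unfolding bad_def by (intro measure_Un_le) auto
    also have "measure_pmf.prob Q {A. \<bar>K A\<bar> \<ge> C * real n} \<le> 1 / C\<^sup>2"
    proof -
      have "measure_pmf.prob Q {A. \<bar>K A\<bar> \<ge> C * real n} \<le>
          measure_pmf.expectation Q (\<lambda>A. (K A)\<^sup>2) / (C * real n)\<^sup>2"
        using measure_pmf.second_moment_method[of K Q "C * real n"] C n0 by (simp add: Q_def)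
      also have "\<dots> = N * p * (1 - p) / (C * real n)\<^sup>2"
        using p by (simp add: Q_def K_def N_def expectation_signed_edge_count_square)
      \<comment> \<open>The variance is at most \<open>n^2\<close>, which is why
        \<open>C * n\<close> is the right threshold for the edge count.\<close>
      also have "\<dots> \<le> (real n)\<^sup>2 * 1 * 1 / (C * real n)\<^sup>2"
        using p n0 C(1) by (intro divide_right_mono mult_mono)
          (auto simp: N_def real_choose_two power2_eq_square field_simps)
      also have "\<dots> = 1 / C\<^sup>2" using n0 by (simp add: power_mult_distrib)
      finally show ?thesis .
    qed
    also have "measure_pmf.prob Q {A. \<bar>LR A - Y A\<bar> \<ge> C / sqrt (real n)} \<le> D / C\<^sup>2"
    proof -
      have "measure_pmf.prob Q {A. \<bar>LR A - Y A\<bar> \<ge> C / sqrt (real n)} \<le>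
          measure_pmf.expectation Q (\<lambda>A. (LR A - Y A)\<^sup>2) / (C / sqrt (real n))\<^sup>2"
        using measure_pmf.second_moment_method[of "\<lambda>A. LR A - Y A" Q "C / sqrt (real n)"] C n0
        by (simp add: Q_def)
      also have "\<dots> \<le> (D / real n) / (C / sqrt (real n))\<^sup>2"
        using expectation_likelihood_ratio_minus_product[OF p, of n l] n l
        by (intro divide_right_mono) (simp_all add: D_def r_def LR_def Y_def Q_def \<mu>_def)
      also have "\<dots> = D / C\<^sup>2" using n0 by (simp add: power_divide)
      finally show ?thesis .
    qed
    also have "1 / C\<^sup>2 + D / C\<^sup>2 = \<epsilon>"
      using C(2) by (simp add: add_divide_distrib)
    finally show ?thesis by simp
  qed
  moreover have "\<forall>\<^sub>F n in sequentially. 2 \<le> n \<and> nat \<lceil>r\<rceil> \<le> n \<and> nat \<lceil>(C / \<delta>)\<^sup>2\<rceil> \<le> n"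
    by (intro eventually_conj eventually_ge_at_top)
  then have "\<forall>\<^sub>F n in sequentially. 2 \<le> n \<and> r \<le> real n \<and> (C / \<delta>)\<^sup>2 \<le> real n"
    unfolding nat_ceiling_le_eq .
  ultimately show "\<exists>C'>0. \<forall>\<^sub>F n in sequentially.
      \<P>(A in measure_pmf (erdos_renyi n q). \<bar>?X n A / (1 / (p * sqrt (real n)))\<bar> > C') \<le> \<epsilon>"
    by (blast intro: eventually_mono)
qed

end
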